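(* Let $R$ be a commutative Noetherian ring with unity, $\lambda$ a length function on $R$-modules, $S=R[x_1,\dots,x_k]$, $N$ an $S$-module and $V_0\le N$ an $R$-submodule which is finitely generated as an $R$-module and satisfies $\lambda(V_0)<\infty$. Let $G_{V_0}(t)=\sum_{n\in\mathbb{N}}\lambda(S_nV_0)t^n$. Then each $\lambda(S_nV_0)$ is finite, and there exists a polynomial $p(t)\in\mathbb{R}[t]$ such that \[G_{V_0}(t)=\frac{p(t)}{(1-t)^{k+1}}.\]
   Context: A length function on $R$-modules is a function $\lambda$ from $R$-modules to $\mathbb{R}_{\ge0}\cup\{\infty\}$ with $\lambda(0)=0$, invariant under isomorphism, additive on short exact sequences, and with $\lambda(M)=\sup\{\lambda(M'):M'\le M$ finitely generated$\}$. $S_n$ is the $R$-module of polynomials in $S$ of total degree at most $n$, and $S_nV_0$ is the $R$-submodule of $N$ generated by the products $pv$, $p\in S_n$, $v\in V_0$. *)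

theory Defs
  imports "HOL-Algebra.Module" "HOL-Algebra.Ring_Divisibility"
          "HOL-Computational_Algebra.Polynomial_FPS"
          "HOL-Library.Extended_Nonnegative_Real"
begin

definition mod_span :: "('a, 'x) ring_scheme \<Rightarrow> ('a, 'b, 'm) module_scheme \<Rightarrow> 'b set \<Rightarrow> 'b set" where
  "mod_span R M A = \<Inter>{H. submodule H R M \<and> A \<subseteq> H}"

definition fg_submodule :: "('a, 'x) ring_scheme \<Rightarrow> ('a, 'b, 'm) module_scheme \<Rightarrow> 'b set \<Rightarrow> bool" where
  "fg_submodule R M H \<longleftrightarrow> submodule H R M \<and>
     (\<exists>A. finite A \<and> A \<subseteq> carrier M \<and> H = mod_span R M A)"

definition mod_hom :: "('a, 'x) ring_scheme \<Rightarrow> ('a, 'b, 'm) module_scheme \<Rightarrow> ('a, 'c, 'n) module_scheme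
    \<Rightarrow> ('b \<Rightarrow> 'c) \<Rightarrow> bool" where
  "mod_hom R M M' f \<longleftrightarrow>
     (\<forall>x\<in>carrier M. f x \<in> carrier M') \<and>
     (\<forall>x\<in>carrier M. \<forall>y\<in>carrier M. f (x \<oplus>\<^bsub>M\<^esub> y) = f x \<oplus>\<^bsub>M'\<^esub> f y) \<and>
     (\<forall>a\<in>carrier R. \<forall>x\<in>carrier M. f (a \<odot>\<^bsub>M\<^esub> x) = a \<odot>\<^bsub>M'\<^esub> f x)"

definition length_function :: "('a, 'x) ring_scheme \<Rightarrow> (('a, 'c) module \<Rightarrow> ennreal) \<Rightarrow> bool" where
  "length_function R l \<longleftrightarrow>
     (\<forall>M. module R M \<and> carrier M = {\<zero>\<^bsub>M\<^esub>} \<longrightarrow> l M = 0) \<and>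
     (\<forall>M M' f. module R M \<and> module R M' \<and> mod_hom R M M' f \<and> bij_betw f (carrier M) (carrier M')
        \<longrightarrow> l M = l M') \<and>
     (\<forall>A B C f g. module R A \<and> module R B \<and> module R C \<and> mod_hom R A B f \<and> mod_hom R B C g \<and>
        inj_on f (carrier A) \<and> g ` carrier B = carrier C \<and>
        f ` carrier A = {y \<in> carrier B. g y = \<zero>\<^bsub>C\<^esub>}
        \<longrightarrow> l B = l A + l C) \<and>
     (\<forall>M. module R M \<longrightarrow> l M = (SUP H \<in> {H. fg_submodule R M H}. l (M\<lparr>carrier := H\<rparr>)))"

(* S_n V_0 for an S = R[x_0,...,x_{k-1}]-module given as an R-module N with k commuting
   R-linear endomorphisms X 0, ..., X (k-1) (the actions of the variables):
   the R-submodule generated by all m v with m a monomial of degree \<le> n and v \<in> V_0.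
   A monomial of degree d is represented by a word of length d over {..<k}. *)
definition SnV :: "('a, 'x) ring_scheme \<Rightarrow> ('a, 'b, 'm) module_scheme \<Rightarrow> nat \<Rightarrow> (nat \<Rightarrow> 'b \<Rightarrow> 'b)
    \<Rightarrow> 'b set \<Rightarrow> nat \<Rightarrow> 'b set" where
  "SnV R N k X V0 n = mod_span R N
     {foldr X ws v | ws v. set ws \<subseteq> {..<k} \<and> length ws \<le> n \<and> v \<in> V0}"

end

theory Submission
  imports Defs "HOL-Library.Multiset_Order"
begin

text \<open>
  Adjoining the identity as a further variable makes the family \<open>S\<^sub>n V\<^sub>0\<close> a graded module in \<open>k + 1\<close>
  variables, generated in degree 0. As in Hilbert's basis theorem, the submodules of leading
  coefficients, indexed by monomials, have only finitely many jumps (Dickson's lemma and the ascending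
  chain condition in \<open>V\<^sub>0\<close>), so every graded submodule is generated in bounded degrees. The series is
  then computed by the Hilbert--Serre induction on the number of variables, where only subquotients
  \<open>A / B\<close> by families of submodules of \<open>N\<close> occur: multiplication by a variable has its kernel and
  cokernel of the same form, and additivity of the length gives one factor \<open>1 - t\<close>.
\<close>

section \<open>Submodules\<close>

text \<open>The length is defined only on modules carried by the type of \<open>N\<close>, so
  neither the polynomial module \<open>V[x]\<close> nor the direct sum of the graded pieces is
  formed: a graded module is a degree-indexed family of submodules of \<open>N\<close>, whose
  members may overlap. In the same way \<open>lead V C\<close> is read off inside \<open>N\<close>.
  It is the leading coefficient module of the preimage of \<open>C\<close> under the evaluation
  \<open>V[x] -> N\<close> in each degree, so relations between the elements
  \<open>act \<beta> v\<close> are already absorbed in it. Bounded generation is proved for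
  arbitrary graded subfamilies because the kernel of multiplication by a variable need not be
  generated in degree 0. It is used only at the bottom of the induction, where all variables act as
  zero on the quotient and generation in bounded degrees forces the quotient to vanish in large
  degrees; this is where the Noetherian hypothesis enters. Finite length of \<open>V0\<close> enters
  separately: it makes all lengths inside the family finite, so that real differences
  \<open>rlen (A n) - rlen (B n)\<close> can stand for the lengths of the quotients.\<close>

context module
begin

lemma submodule_zero_closed: "submodule H R M \<Longrightarrow> \<zero>\<^bsub>M\<^esub> \<in> H"
  using subgroup.one_closed[OF submodule.axioms(1)] by fastforce

lemma submodule_minus_closed:
  assumes "submodule H R M" "x \<in> H" "y \<in> H"
  shows "x \<ominus>\<^bsub>M\<^esub> y \<in> H"
  using submoduleE[OF assms(1)] assms unfolding a_minus_def by blast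

lemma submodule_mem_carrier: "submodule H R M \<Longrightarrow> x \<in> H \<Longrightarrow> x \<in> carrier M"
  using submoduleE(1) by blast

lemma submodule_zero: "submodule {\<zero>\<^bsub>M\<^esub>} R M"
  by (rule submoduleI) auto

lemma submodule_Int:
  assumes "submodule A R M" "submodule B R M"
  shows "submodule (A \<inter> B) R M"
  by (rule submoduleI)
    (use submoduleE(1)[OF assms(1)] submodule_zero_closed[OF assms(1)] submodule_zero_closed[OF assms(2)]
      in \<open>auto simp: submoduleE(3-5)[OF assms(1)] submoduleE(3-5)[OF assms(2)]\<close>)

lemma mem_set_add_iff: "x \<in> A <+>\<^bsub>M\<^esub> B \<longleftrightarrow> (\<exists>a\<in>A. \<exists>b\<in>B. x = a \<oplus>\<^bsub>M\<^esub> b)"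
  by (auto simp: set_add_def')

lemma submodule_set_add:
  assumes A: "submodule A R M" and B: "submodule B R M"
  shows "submodule (A <+>\<^bsub>M\<^esub> B) R M"
proof (rule submoduleI)
  note cA = submodule_mem_carrier[OF A] and cB = submodule_mem_carrier[OF B]
  show "A <+>\<^bsub>M\<^esub> B \<subseteq> carrier M"
    using cA cB by (auto simp: mem_set_add_iff)
  show "\<zero>\<^bsub>M\<^esub> \<in> A <+>\<^bsub>M\<^esub> B"
    unfolding mem_set_add_iff using submodule_zero_closed[OF A] submodule_zero_closed[OF B]
    by (metis M.l_zero M.zero_closed)
  fix x assume "x \<in> A <+>\<^bsub>M\<^esub> B"
  then obtain a b where x: "a \<in> A" "b \<in> B" "x = a \<oplus>\<^bsub>M\<^esub> b"
    unfolding mem_set_add_iff by blast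
  show "\<ominus>\<^bsub>M\<^esub> x \<in> A <+>\<^bsub>M\<^esub> B"
    unfolding mem_set_add_iff using x cA cB submoduleE(3)[OF A] submoduleE(3)[OF B]
    by (metis M.minus_add)
  show "r \<odot>\<^bsub>M\<^esub> x \<in> A <+>\<^bsub>M\<^esub> B" if "r \<in> carrier R" for r
    unfolding mem_set_add_iff using x cA cB submoduleE(4)[OF A] submoduleE(4)[OF B] that
    by (metis smult_r_distr)
  fix y assume "y \<in> A <+>\<^bsub>M\<^esub> B"
  then obtain a' b' where y: "a' \<in> A" "b' \<in> B" "y = a' \<oplus>\<^bsub>M\<^esub> b'"
    unfolding mem_set_add_iff by blast
  have "x \<oplus>\<^bsub>M\<^esub> y = (a \<oplus>\<^bsub>M\<^esub> a') \<oplus>\<^bsub>M\<^esub> (b \<oplus>\<^bsub>M\<^esub> b')"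
    using x y cA cB by (simp add: M.a_ac)
  then show "x \<oplus>\<^bsub>M\<^esub> y \<in> A <+>\<^bsub>M\<^esub> B"
    unfolding mem_set_add_iff using x y submoduleE(5)[OF A] submoduleE(5)[OF B] by blast
qed

lemma set_add_upper1: "A \<subseteq> carrier M \<Longrightarrow> submodule B R M \<Longrightarrow> A \<subseteq> A <+>\<^bsub>M\<^esub> B"
  unfolding subset_eq mem_set_add_iff using submodule_zero_closed M.r_zero by metis

lemma set_add_upper2: "submodule A R M \<Longrightarrow> B \<subseteq> carrier M \<Longrightarrow> B \<subseteq> A <+>\<^bsub>M\<^esub> B"
  unfolding subset_eq mem_set_add_iff using submodule_zero_closed M.l_zero by metis

lemma set_add_least: "submodule H R M \<Longrightarrow> A \<subseteq> H \<Longrightarrow> B \<subseteq> H \<Longrightarrow> A <+>\<^bsub>M\<^esub> B \<subseteq> H"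
  by (auto simp: mem_set_add_iff intro!: submoduleE(5))

section \<open>Spans of subsets\<close>

lemma submodule_mod_span:
  assumes "A \<subseteq> carrier M"
  shows "submodule (mod_span R M A) R M"
proof (rule submoduleI)
  show "mod_span R M A \<subseteq> carrier M"
    unfolding mod_span_def using carrier_is_submodule assms by blast
qed (auto simp: mod_span_def submodule_zero_closed dest: submoduleE)

lemma mod_span_upper: "A \<subseteq> mod_span R M A"
  unfolding mod_span_def by blast

lemma mod_span_least: "submodule H R M \<Longrightarrow> A \<subseteq> H \<Longrightarrow> mod_span R M A \<subseteq> H"
  unfolding mod_span_def by blast

lemma mod_span_mono: "A \<subseteq> B \<Longrightarrow> mod_span R M A \<subseteq> mod_span R M B"
  unfolding mod_span_def by blast

lemma submodule_smult_image:
  assumes "v \<in> carrier M"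
  shows "submodule ((\<lambda>r. r \<odot>\<^bsub>M\<^esub> v) ` carrier R) R M"
proof (rule submoduleI)
  show "\<zero>\<^bsub>M\<^esub> \<in> (\<lambda>r. r \<odot>\<^bsub>M\<^esub> v) ` carrier R"
    using assms by (intro image_eqI[of _ _ \<zero>]) auto
next
  fix a assume "a \<in> (\<lambda>r. r \<odot>\<^bsub>M\<^esub> v) ` carrier R"
  then obtain r where "r \<in> carrier R" "a = r \<odot>\<^bsub>M\<^esub> v" by blast
  then show "\<ominus>\<^bsub>M\<^esub> a \<in> (\<lambda>r. r \<odot>\<^bsub>M\<^esub> v) ` carrier R"
    using assms by (intro image_eqI[of _ _ "\<ominus> r"]) (auto simp: smult_l_minus)
next
  fix a b assume "a \<in> (\<lambda>r. r \<odot>\<^bsub>M\<^esub> v) ` carrier R" "b \<in> (\<lambda>r. r \<odot>\<^bsub>M\<^esub> v) ` carrier R"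
  then obtain r s where "r \<in> carrier R" "a = r \<odot>\<^bsub>M\<^esub> v" "s \<in> carrier R" "b = s \<odot>\<^bsub>M\<^esub> v" by blast
  then show "a \<oplus>\<^bsub>M\<^esub> b \<in> (\<lambda>r. r \<odot>\<^bsub>M\<^esub> v) ` carrier R"
    using assms by (intro image_eqI[of _ _ "r \<oplus> s"]) (auto simp: smult_l_distr)
next
  fix a x assume a: "a \<in> carrier R" and "x \<in> (\<lambda>r. r \<odot>\<^bsub>M\<^esub> v) ` carrier R"
  then obtain r where "r \<in> carrier R" "x = r \<odot>\<^bsub>M\<^esub> v" by blast
  then show "a \<odot>\<^bsub>M\<^esub> x \<in> (\<lambda>r. r \<odot>\<^bsub>M\<^esub> v) ` carrier R"
    using assms a by (intro image_eqI[of _ _ "a \<otimes> r"]) (auto simp: smult_assoc1)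
qed (use assms in auto)

lemma mod_span_insert_subset:
  assumes "v \<in> carrier M" "A \<subseteq> carrier M"
  shows "mod_span R M (insert v A) \<subseteq> mod_span R M A <+>\<^bsub>M\<^esub> (\<lambda>r. r \<odot>\<^bsub>M\<^esub> v) ` carrier R"
proof (rule mod_span_least)
  note sub = submodule_mod_span[OF assms(2)] submodule_smult_image[OF assms(1)]
  show "submodule (mod_span R M A <+>\<^bsub>M\<^esub> (\<lambda>r. r \<odot>\<^bsub>M\<^esub> v) ` carrier R) R M"
    using sub by (rule submodule_set_add)
  have "v \<in> (\<lambda>r. r \<odot>\<^bsub>M\<^esub> v) ` carrier R"
    using assms(1) smult_one by (metis R.one_closed image_eqI)
  then show "insert v A \<subseteq> mod_span R M A <+>\<^bsub>M\<^esub> (\<lambda>r. r \<odot>\<^bsub>M\<^esub> v) ` carrier R"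
    using set_add_upper2[OF sub(1) submoduleE(1)[OF sub(2)]]
      set_add_upper1[OF submoduleE(1)[OF sub(1)] sub(2)] mod_span_upper[of A] by blast
qed

section \<open>Endomorphisms, images and preimages\<close>

lemma mod_homD:
  assumes "mod_hom R M M' h"
  shows "x \<in> carrier M \<Longrightarrow> h x \<in> carrier M'"
    and "x \<in> carrier M \<Longrightarrow> y \<in> carrier M \<Longrightarrow> h (x \<oplus>\<^bsub>M\<^esub> y) = h x \<oplus>\<^bsub>M'\<^esub> h y"
    and "r \<in> carrier R \<Longrightarrow> x \<in> carrier M \<Longrightarrow> h (r \<odot>\<^bsub>M\<^esub> x) = r \<odot>\<^bsub>M'\<^esub> h x"
  using assms unfolding mod_hom_def by simp_all

lemma mod_hom_zero:
  assumes "mod_hom R M M h"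
  shows "h \<zero>\<^bsub>M\<^esub> = \<zero>\<^bsub>M\<^esub>"
  using mod_homD(3)[OF assms R.zero_closed M.zero_closed]
    mod_homD(1)[OF assms M.zero_closed] by simp

lemma mod_hom_minus:
  assumes h: "mod_hom R M M h" and "x \<in> carrier M"
  shows "h (\<ominus>\<^bsub>M\<^esub> x) = \<ominus>\<^bsub>M\<^esub> h x"
proof -
  have "h (\<ominus>\<^bsub>M\<^esub> x) \<oplus>\<^bsub>M\<^esub> h x = \<zero>\<^bsub>M\<^esub>"
    using mod_homD(2)[OF h, of "\<ominus>\<^bsub>M\<^esub> x" x] mod_hom_zero[OF h] assms(2) by (simp add: M.l_neg)
  then show ?thesis
    using mod_homD(1)[OF h] assms(2) by (simp add: M.minus_equality)
qed

lemma submodule_hom_image: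
  assumes h: "mod_hom R M M h" and A: "submodule A R M"
  shows "submodule (h ` A) R M"
proof (rule submoduleI)
  note cA = submodule_mem_carrier[OF A]
  have hadd: "\<And>x y. x \<in> A \<Longrightarrow> y \<in> A \<Longrightarrow> h (x \<oplus>\<^bsub>M\<^esub> y) = h x \<oplus>\<^bsub>M\<^esub> h y"
    and hsm: "\<And>r x. r \<in> carrier R \<Longrightarrow> x \<in> A \<Longrightarrow> h (r \<odot>\<^bsub>M\<^esub> x) = r \<odot>\<^bsub>M\<^esub> h x"
    and hc: "\<And>x. x \<in> A \<Longrightarrow> h x \<in> carrier M"
    using mod_homD[OF h] cA by simp_all
  show "h ` A \<subseteq> carrier M" using hc by blast
  show "\<zero>\<^bsub>M\<^esub> \<in> h ` A"
    using mod_hom_zero[OF h] submodule_zero_closed[OF A] by (metis image_eqI)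
  show "\<ominus>\<^bsub>M\<^esub> a \<in> h ` A" if "a \<in> h ` A" for a
    using that mod_hom_minus[OF h] cA submoduleE(3)[OF A]
    by (metis (no_types, opaque_lifting) image_iff)
  show "a \<oplus>\<^bsub>M\<^esub> b \<in> h ` A" if "a \<in> h ` A" "b \<in> h ` A" for a b
    using that hadd submoduleE(5)[OF A] by (metis (no_types, opaque_lifting) image_iff)
  show "r \<odot>\<^bsub>M\<^esub> a \<in> h ` A" if "r \<in> carrier R" "a \<in> h ` A" for r a
    using that hsm submoduleE(4)[OF A] by (metis (no_types, opaque_lifting) image_iff)
qed

lemma submodule_hom_preimage:
  assumes h: "mod_hom R M M h" and A: "submodule A R M" and B: "submodule B R M"
  shows "submodule {a \<in> A. h a \<in> B} R M"
proof (rule submoduleI)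
  note cA = submodule_mem_carrier[OF A]
  show "{a \<in> A. h a \<in> B} \<subseteq> carrier M" using cA by blast
  show "\<zero>\<^bsub>M\<^esub> \<in> {a \<in> A. h a \<in> B}"
    using submodule_zero_closed A B mod_hom_zero[OF h] by auto
  show "\<ominus>\<^bsub>M\<^esub> a \<in> {a \<in> A. h a \<in> B}" if "a \<in> {a \<in> A. h a \<in> B}" for a
    using that submoduleE(3)[OF A] submoduleE(3)[OF B] mod_hom_minus[OF h cA] by simp
  show "a \<oplus>\<^bsub>M\<^esub> b \<in> {a \<in> A. h a \<in> B}"
    if "a \<in> {a \<in> A. h a \<in> B}" "b \<in> {a \<in> A. h a \<in> B}" for a b
    using that submoduleE(5)[OF A] submoduleE(5)[OF B] mod_homD(2)[OF h cA cA] by simp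
  show "r \<odot>\<^bsub>M\<^esub> a \<in> {a \<in> A. h a \<in> B}" if "r \<in> carrier R" "a \<in> {a \<in> A. h a \<in> B}" for r a
    using that submoduleE(4)[OF A] submoduleE(4)[OF B] mod_homD(3)[OF h _ cA] by simp
qed

text \<open>The preimage of \<open>H\<close> is a submodule containing the generators, hence the
  whole span.\<close>

lemma hom_image_mod_span:
  assumes h: "mod_hom R M M h" and "A \<subseteq> carrier M" and H: "submodule H R M" and "h ` A \<subseteq> H"
  shows "h ` mod_span R M A \<subseteq> H"
  using mod_span_least[OF submodule_hom_preimage[OF h carrier_is_submodule H], of A] assms
  by blast

lemma mod_hom_comp:
  assumes "mod_hom R M M f" "mod_hom R M M g"
  shows "mod_hom R M M (\<lambda>x. f (g x))"
  using assms unfolding mod_hom_def by simp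

lemma mod_hom_id: "mod_hom R M M (\<lambda>x. x)"
  unfolding mod_hom_def by simp

end

section \<open>Ascending chains\<close>

context module
begin

text \<open>Chains instead of finite generation: in this form the condition is applied to leading
  coefficient modules along a Dickson subsequence.\<close>

definition noeth_submodule where
  "noeth_submodule H \<longleftrightarrow> (\<forall>C. (\<forall>n. submodule (C n) R M \<and> C n \<subseteq> H \<and> C n \<subseteq> C (Suc n))
     \<longrightarrow> (\<exists>n::nat. \<forall>i\<ge>n. C i = C n))"

lemma noeth_submodule_subset:
  "noeth_submodule H \<Longrightarrow> H' \<subseteq> H \<Longrightarrow> noeth_submodule H'"
  unfolding noeth_submodule_def by (meson order_trans)

text \<open>A chain \<open>C\<close> is controlled by its traces on \<open>P\<close> and by its
  images in the cyclic quotient modulo \<open>P\<close>. The traces stabilise by assumption, the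
  images because they correspond to ideals of \<open>R\<close>; once both are constant, so is
  \<open>C\<close>.\<close>

lemma noeth_submodule_add_cyclic:
  assumes noeth: "noetherian_ring R" and P: "submodule P R M" "noeth_submodule P"
    and v: "v \<in> carrier M"
  shows "noeth_submodule (P <+>\<^bsub>M\<^esub> (\<lambda>r. r \<odot>\<^bsub>M\<^esub> v) ` carrier R)"
  unfolding noeth_submodule_def
proof (intro allI impI)
  fix C assume C: "\<forall>n::nat. submodule (C n) R M \<and>
     C n \<subseteq> P <+>\<^bsub>M\<^esub> (\<lambda>r. r \<odot>\<^bsub>M\<^esub> v) ` carrier R \<and> C n \<subseteq> C (Suc n)"
  then have subC: "\<And>n. submodule (C n) R M" by blast
  have mono: "C i \<subseteq> C j" if "i \<le> j" for i j
    by (rule lift_Suc_mono_le[OF _ that]) (use C in blast)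
  \<comment> \<open>The ideal of \<open>R\<close> that describes the image of \<open>C n\<close> in
    the cyclic quotient by \<open>P\<close>.\<close>
  define I where "I n = {r \<in> carrier R. r \<odot>\<^bsub>M\<^esub> v \<in> C n <+>\<^bsub>M\<^esub> P}" for n
  have subCP: "submodule (C n <+>\<^bsub>M\<^esub> P) R M" for n
    using subC P by (blast intro: submodule_set_add)
  have I: "ideal (I n) R" for n
  proof (rule idealI)
    show "ring R" by (rule R.ring_axioms)
    show "subgroup (I n) (add_monoid R)"
    proof (rule group.subgroupI[OF R.a_group])
      have "\<zero> \<in> I n"
        unfolding I_def using v submodule_zero_closed[OF subCP] by simp
      then show "I n \<noteq> {}" by blast
      show "inv\<^bsub>add_monoid R\<^esub> a \<in> I n" if "a \<in> I n" for a
      proof -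
        have "\<ominus> a \<in> I n"
          using that v submoduleE(3)[OF subCP] unfolding I_def by (auto simp: smult_l_minus)
        then show ?thesis by (simp add: a_inv_def)
      qed
      show "a \<otimes>\<^bsub>add_monoid R\<^esub> b \<in> I n" if "a \<in> I n" "b \<in> I n" for a b
        using that v submoduleE(5)[OF subCP] unfolding I_def by (auto simp: smult_l_distr)
    qed (auto simp: I_def)
    show "x \<otimes> a \<in> I n" if "a \<in> I n" "x \<in> carrier R" for a x
      using that v submoduleE(4)[OF subCP] unfolding I_def by (auto simp: smult_assoc1)
    then show "a \<otimes> x \<in> I n" if "a \<in> I n" "x \<in> carrier R" for a x
      using that R.m_comm unfolding I_def by auto
  qed
  have I_mono: "I i \<subseteq> I j" if "i \<le> j" for i j
    using mono[OF that] unfolding I_def mem_set_add_iff by blast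
  have "\<Union>(range I) \<in> range I"
  proof (rule noetherian_ring.ideal_chain_is_trivial[OF noeth])
    show "subset.chain {I. ideal I R} (range I)"
      unfolding subset_chain_def using I I_mono nat_le_linear by blast
  qed simp
  then obtain n1 where n1: "\<Union>(range I) = I n1" by blast
  have "\<exists>n. \<forall>i\<ge>n. C i \<inter> P = C n \<inter> P"
    by (rule P(2)[unfolded noeth_submodule_def, rule_format])
      (use subC P(1) submodule_Int mono[OF le_SucI[OF order_refl]] in blast)
  then obtain n2 where n2: "\<And>i. i \<ge> n2 \<Longrightarrow> C i \<inter> P = C n2 \<inter> P" by blast
  show "\<exists>n. \<forall>i\<ge>n. C i = C n"
  proof (intro exI allI impI)
    fix i assume i: "max n1 n2 \<le> i"
    define n where "n = max n1 n2"
    have "C i \<subseteq> C n"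
    proof
      fix d assume d: "d \<in> C i"
      then have "d \<in> P <+>\<^bsub>M\<^esub> (\<lambda>r. r \<odot>\<^bsub>M\<^esub> v) ` carrier R" using C by blast
      then obtain p r where p: "p \<in> P" and r: "r \<in> carrier R" and d_eq: "d = p \<oplus>\<^bsub>M\<^esub> r \<odot>\<^bsub>M\<^esub> v"
        unfolding mem_set_add_iff by blast
      have pM: "p \<in> carrier M" and dM: "d \<in> carrier M" and rvM: "r \<odot>\<^bsub>M\<^esub> v \<in> carrier M"
        using submodule_mem_carrier[OF P(1) p] submodule_mem_carrier[OF subC d] r v by auto
      have "r \<odot>\<^bsub>M\<^esub> v = d \<oplus>\<^bsub>M\<^esub> (\<ominus>\<^bsub>M\<^esub> p)"
        unfolding d_eq using pM rvM by (simp add: M.a_ac M.r_neg1 M.r_neg2)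
      then have "r \<odot>\<^bsub>M\<^esub> v \<in> C i <+>\<^bsub>M\<^esub> P"
        unfolding mem_set_add_iff using d submoduleE(3)[OF P(1) p] by blast
      then have "r \<in> I i"
        unfolding I_def using r by blast
      then have "r \<in> I n"
        using n1 I_mono[of n1 n] unfolding n_def by auto
      then have "r \<odot>\<^bsub>M\<^esub> v \<in> C n <+>\<^bsub>M\<^esub> P"
        unfolding I_def by blast
      then obtain c q where c: "c \<in> C n" and q: "q \<in> P" and eq: "r \<odot>\<^bsub>M\<^esub> v = c \<oplus>\<^bsub>M\<^esub> q"
        unfolding mem_set_add_iff by blast
      have qM: "q \<in> carrier M" and cM: "c \<in> carrier M"
        using submodule_mem_carrier[OF P(1) q] submodule_mem_carrier[OF subC c] by auto
      \<comment> \<open>The part of \<open>d\<close> outside \<open>P\<close> is matched by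
        \<open>c\<close> in \<open>C n\<close>; the correction \<open>p + q\<close> lies in
        \<open>C i\<close> and in \<open>P\<close>, so the stable traces put it into
        \<open>C n\<close>.\<close>
      have d_eq': "d = c \<oplus>\<^bsub>M\<^esub> (p \<oplus>\<^bsub>M\<^esub> q)"
        unfolding d_eq eq using pM qM cM by (simp add: M.a_ac)
      have "p \<oplus>\<^bsub>M\<^esub> q = d \<ominus>\<^bsub>M\<^esub> c"
        unfolding d_eq' using pM qM cM by (simp add: a_minus_def M.a_comm[of c] M.a_assoc M.r_neg)
      then have "p \<oplus>\<^bsub>M\<^esub> q \<in> C i \<inter> P"
        using submodule_minus_closed[OF subC d] c mono[of n i] i submoduleE(5)[OF P(1) p q]
        unfolding n_def by auto
      then have "p \<oplus>\<^bsub>M\<^esub> q \<in> C n"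
        using n2[of i] n2[of n] i unfolding n_def by auto
      then show "d \<in> C n"
        unfolding d_eq' using c submoduleE(5)[OF subC] by blast
    qed
    then show "C i = C (max n1 n2)"
      using mono[OF i] unfolding n_def by blast
  qed
qed

lemma noeth_submodule_mod_span:
  assumes "noetherian_ring R" "finite A" "A \<subseteq> carrier M"
  shows "noeth_submodule (mod_span R M A)"
  using assms(2,3)
proof (induction A)
  case empty
  have "mod_span R M {} \<subseteq> {\<zero>\<^bsub>M\<^esub>}"
    by (rule mod_span_least[OF submodule_zero]) simp
  moreover have "noeth_submodule {\<zero>\<^bsub>M\<^esub>}"
    unfolding noeth_submodule_def using submodule_zero_closed
    by (metis (no_types, opaque_lifting) empty_iff subset_singletonD)
  ultimately show ?case by (rule noeth_submodule_subset[rotated])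
next
  case (insert v A)
  then show ?case
    using noeth_submodule_subset[OF noeth_submodule_add_cyclic[OF assms(1)] mod_span_insert_subset]
      submodule_mod_span by simp
qed

end

section \<open>Dickson's lemma for multisets\<close>

text \<open>A monotone subsequence always exists; a decreasing one becomes constant once it reaches
  its minimum, so its tail is increasing as well.\<close>

lemma nat_seq_incseq_subseq:
  fixes a :: "nat \<Rightarrow> nat"
  obtains r where "strict_mono r" "incseq (a \<circ> r)"
proof -
  obtain f where f: "strict_mono f" "monoseq (\<lambda>n. a (f n))"
    using seq_monosub[of a] by blast
  show thesis
  proof (cases "incseq (\<lambda>n. a (f n))")
    case True
    then show ?thesis using that[OF f(1)] by (simp add: comp_def)
  next
    case False
    then have dec: "decseq (\<lambda>n. a (f n))"
      using f(2) by (simp add: monoseq_iff)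
    define k where "k = (LEAST y. y \<in> range (\<lambda>n. a (f n)))"
    have "k \<in> range (\<lambda>n. a (f n))"
      unfolding k_def by (rule LeastI[of _ "a (f 0)"]) simp
    then obtain n where n: "a (f n) = k" by auto
    have "a (f (n + i)) = k" for i
    proof (rule antisym)
      show "a (f (n + i)) \<le> k" using decseqD[OF dec, of n "n + i"] n by simp
      show "k \<le> a (f (n + i))" unfolding k_def by (rule Least_le) simp
    qed
    moreover have "strict_mono (\<lambda>i. f (n + i))"
      using f(1) by (simp add: strict_mono_def)
    ultimately show ?thesis
      by (intro that[of "\<lambda>i. f (n + i)"]) (auto simp: incseq_def)
  qed
qed

text \<open>Subsequences are refined one element of \<open>A\<close> at a time, and multiplicities
  already monotone stay so. A whole chain is produced, not just one comparable pair, since the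
  ascending chain condition is to be applied along it.\<close>

lemma dickson_mset:
  fixes a :: "nat \<Rightarrow> 'a multiset"
  assumes "finite A" "\<And>n. set_mset (a n) \<subseteq> A"
  obtains r :: "nat \<Rightarrow> nat" where "strict_mono r" "\<And>i j. i \<le> j \<Longrightarrow> a (r i) \<subseteq># a (r j)"
proof -
  have "\<exists>r :: nat \<Rightarrow> nat. strict_mono r \<and> (\<forall>x\<in>A. incseq (\<lambda>n. count (a (r n)) x))"
    using assms(1)
  proof (induction A)
    case empty
    show ?case by (intro exI[of _ id]) (simp add: strict_mono_def)
  next
    case (insert x A)
    then obtain r where r: "strict_mono r" "\<And>y. y \<in> A \<Longrightarrow> incseq (\<lambda>n. count (a (r n)) y)"
      by blast
    obtain s where s: "strict_mono s" "incseq ((\<lambda>n. count (a (r n)) x) \<circ> s)"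
      using nat_seq_incseq_subseq .
    have "incseq (\<lambda>n. count (a ((r \<circ> s) n)) y)" if "y \<in> insert x A" for y
      using that s r(2)[of y] strict_mono_less_eq[OF s(1)] by (auto simp: incseq_def)
    then show ?case
      using strict_mono_o[OF r(1) s(1)] by blast
  qed
  then obtain r where r: "strict_mono r" "\<And>x. x \<in> A \<Longrightarrow> incseq (\<lambda>n. count (a (r n)) x)"
    by blast
  show thesis
  proof (rule that[OF r(1)])
    fix i j :: nat assume "i \<le> j"
    have "count (a (r i)) x \<le> count (a (r j)) x" for x
    proof (cases "x \<in> A")
      case True
      then show ?thesis using incseqD[OF r(2) \<open>i \<le> j\<close>] by simp
    next
      case False
      then have "count (a (r i)) x = 0"
        using assms(2)[of "r i"] by (auto simp: count_eq_zero_iff)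
      then show ?thesis by simp
    qed
    then show "a (r i) \<subseteq># a (r j)" by (simp add: subseteq_mset_def)
  qed
qed

section \<open>Graded families of submodules\<close>

text \<open>This is the structure of a module over the polynomial ring in \<open>m\<close>
  variables, without the ring itself: only monomials act.\<close>

locale commuting_endos = module R M
  for R :: "('a, 'x) ring_scheme" (structure) and M :: "('a, 'c, 'y) module_scheme" (structure) +
  fixes m :: nat and X :: "nat \<Rightarrow> 'c \<Rightarrow> 'c"
  assumes endo: "i < m \<Longrightarrow> mod_hom R M M (X i)"
    and endo_commute: "i < m \<Longrightarrow> j < m \<Longrightarrow> v \<in> carrier M \<Longrightarrow> X i (X j v) = X j (X i v)"
begin

lemma foldr_hom: "set ws \<subseteq> {..<m} \<Longrightarrow> mod_hom R M M (foldr X ws)"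
proof (induction ws)
  case Nil
  show ?case by (simp add: mod_hom_def)
next
  case (Cons w ws)
  have "foldr X (w # ws) = (\<lambda>v. X w (foldr X ws v))" by (simp add: fun_eq_iff)
  with Cons show ?case using mod_hom_comp[OF endo, of w "foldr X ws"] by simp
qed

lemma foldr_commute:
  "set ws \<subseteq> {..<m} \<Longrightarrow> i < m \<Longrightarrow> v \<in> carrier M \<Longrightarrow> foldr X ws (X i v) = X i (foldr X ws v)"
proof (induction ws)
  case (Cons w ws)
  then have "foldr X ws v \<in> carrier M"
    using mod_homD(1)[OF foldr_hom] by simp
  with Cons show ?case using endo_commute[of w i] by simp
qed simp

text \<open>The first letter of one word occurs somewhere in the other, and commutativity pulls it
  to the front there.\<close>

lemma foldr_cong_mset:
  "mset ws = mset ws' \<Longrightarrow> set ws \<subseteq> {..<m} \<Longrightarrow> v \<in> carrier M \<Longrightarrow> foldr X ws v = foldr X ws' v"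
proof (induction ws arbitrary: ws')
  case (Cons w ws)
  have "w \<in> set ws'"
    using Cons.prems(1) by (metis list.set_intros(1) mset_eq_setD)
  then obtain p q where ws': "ws' = p @ w # q"
    by (meson split_list)
  have eq: "mset ws = mset (p @ q)"
    using Cons.prems(1) by (simp add: ws')
  have pq: "set (p @ q) \<subseteq> {..<m}"
    using mset_eq_setD[OF eq] Cons.prems(2) by simp
  have "foldr X ws' v = foldr X p (X w (foldr X q v))"
    by (simp add: ws')
  also have "\<dots> = X w (foldr X p (foldr X q v))"
    using foldr_commute[of p w "foldr X q v"] pq Cons.prems mod_homD(1)[OF foldr_hom, of q v] by simp
  also have "\<dots> = X w (foldr X ws v)"
    using Cons.IH[OF eq] Cons.prems by simp
  finally show ?case by simp
qed simp

text \<open>Sorting merely selects one word for the monomial; by commutativity every other word acts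
  in the same way.\<close>

definition act :: "nat multiset \<Rightarrow> 'c \<Rightarrow> 'c" where
  "act \<alpha> v = foldr X (sorted_list_of_multiset \<alpha>) v"

lemma foldr_eq_act: "set ws \<subseteq> {..<m} \<Longrightarrow> v \<in> carrier M \<Longrightarrow> foldr X ws v = act (mset ws) v"
  unfolding act_def by (rule foldr_cong_mset) auto

lemma act_hom: "set_mset \<alpha> \<subseteq> {..<m} \<Longrightarrow> mod_hom R M M (act \<alpha>)"
  using foldr_hom[of "sorted_list_of_multiset \<alpha>"] unfolding act_def by simp

lemma act_closed: "set_mset \<alpha> \<subseteq> {..<m} \<Longrightarrow> v \<in> carrier M \<Longrightarrow> act \<alpha> v \<in> carrier M"
  by (rule mod_homD(1)[OF act_hom])

lemma act_add:
  assumes "set_mset \<alpha> \<subseteq> {..<m}" "set_mset \<beta> \<subseteq> {..<m}" "v \<in> carrier M"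
  shows "act (\<alpha> + \<beta>) v = act \<alpha> (act \<beta> v)"
  using foldr_eq_act[of "sorted_list_of_multiset \<alpha> @ sorted_list_of_multiset \<beta>" v] assms
  by (simp add: act_def)

lemma act_empty [simp]: "act {#} v = v"
  by (simp add: act_def)

lemma act_add_mset:
  assumes "i < m" "set_mset \<alpha> \<subseteq> {..<m}" "v \<in> carrier M"
  shows "act (add_mset i \<alpha>) v = X i (act \<alpha> v)"
  using act_add[of "{#i#}" \<alpha> v] assms by (simp add: act_def)

section \<open>Monomials of fixed degree and the spans of their multiples\<close>

definition monoms :: "nat \<Rightarrow> nat multiset set" where
  "monoms n = {\<alpha>. set_mset \<alpha> \<subseteq> {..<m} \<and> size \<alpha> = n}"

lemma finite_monoms: "finite (monoms n)"
proof -
  have "monoms n \<subseteq> mset ` {ws. set ws \<subseteq> {..<m} \<and> length ws = n}"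
  proof
    fix \<alpha> assume "\<alpha> \<in> monoms n"
    then show "\<alpha> \<in> mset ` {ws. set ws \<subseteq> {..<m} \<and> length ws = n}"
      by (intro image_eqI[of _ _ "sorted_list_of_multiset \<alpha>"])
        (auto simp: monoms_def simp flip: size_mset)
  qed
  then show ?thesis
    by (rule finite_subset) (simp add: finite_lists_length_eq)
qed

definition monom_span :: "'c set \<Rightarrow> nat multiset set \<Rightarrow> 'c set" where
  "monom_span V S = mod_span R M {act \<beta> v | \<beta> v. \<beta> \<in> S \<and> v \<in> V}"

lemma monom_span_gens:
  "V \<subseteq> carrier M \<Longrightarrow> S \<subseteq> {\<alpha>. set_mset \<alpha> \<subseteq> {..<m}} \<Longrightarrow> {act \<beta> v | \<beta> v. \<beta> \<in> S \<and> v \<in> V} \<subseteq> carrier M"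
  using act_closed by blast

lemma submodule_monom_span:
  "V \<subseteq> carrier M \<Longrightarrow> S \<subseteq> {\<alpha>. set_mset \<alpha> \<subseteq> {..<m}} \<Longrightarrow> submodule (monom_span V S) R M"
  unfolding monom_span_def by (rule submodule_mod_span[OF monom_span_gens])

lemma monom_span_mono: "S \<subseteq> T \<Longrightarrow> monom_span V S \<subseteq> monom_span V T"
  unfolding monom_span_def by (rule mod_span_mono) blast

lemma act_image_monom_span:
  assumes V: "V \<subseteq> carrier M" and S: "S \<subseteq> {\<alpha>. set_mset \<alpha> \<subseteq> {..<m}}"
    and T: "T \<subseteq> {\<alpha>. set_mset \<alpha> \<subseteq> {..<m}}" and \<delta>: "set_mset \<delta> \<subseteq> {..<m}" and "(+) \<delta> ` S \<subseteq> T"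
  shows "act \<delta> ` monom_span V S \<subseteq> monom_span V T"
  unfolding monom_span_def[of V S]
proof (rule hom_image_mod_span[OF act_hom[OF \<delta>] monom_span_gens[OF V S] submodule_monom_span[OF V T]])
  show "act \<delta> ` {act \<beta> v | \<beta> v. \<beta> \<in> S \<and> v \<in> V} \<subseteq> monom_span V T"
  proof clarify
    fix \<beta> v assume \<beta>: "\<beta> \<in> S" and v: "v \<in> V"
    have "set_mset \<beta> \<subseteq> {..<m}" "v \<in> carrier M"
      using \<beta> v S V by blast+
    then have "act \<delta> (act \<beta> v) = act (\<delta> + \<beta>) v"
      by (simp add: act_add[OF \<delta>])
    moreover have "act (\<delta> + \<beta>) v \<in> {act \<beta> v | \<beta> v. \<beta> \<in> T \<and> v \<in> V}"
      using assms(5) \<beta> v by blast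
    ultimately show "act \<delta> (act \<beta> v) \<in> monom_span V T"
      unfolding monom_span_def using mod_span_upper by fastforce
  qed
qed

text \<open>Splits off the term at \<open>b\<close>. With \<open>b\<close> the largest monomial
  present, this separates the leading term from the rest.\<close>

lemma monom_span_insert:
  assumes V: "submodule V R M" and S: "S \<subseteq> {\<alpha>. set_mset \<alpha> \<subseteq> {..<m}}" and b: "set_mset b \<subseteq> {..<m}"
  shows "monom_span V (insert b S) \<subseteq> act b ` V <+>\<^bsub>M\<^esub> monom_span V S"
  unfolding monom_span_def[of V "insert b S"]
proof (rule mod_span_least)
  note V' = submoduleE(1)[OF V]
  note 1 = submodule_hom_image[OF act_hom[OF b] V] and 2 = submodule_monom_span[OF V' S]
  show "submodule (act b ` V <+>\<^bsub>M\<^esub> monom_span V S) R M"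
    by (rule submodule_set_add[OF 1 2])
  have "{act \<beta> v | \<beta> v. \<beta> \<in> S \<and> v \<in> V} \<subseteq> monom_span V S"
    unfolding monom_span_def by (rule mod_span_upper)
  then show "{act \<beta> v | \<beta> v. \<beta> \<in> insert b S \<and> v \<in> V} \<subseteq> act b ` V <+>\<^bsub>M\<^esub> monom_span V S"
    using set_add_upper1[OF submoduleE(1)[OF 1] 2] set_add_upper2[OF 1 submoduleE(1)[OF 2]] by blast
qed

text \<open>\<open>C n\<close> plays the role of the degree \<open>n\<close> component of an
  external direct sum; different components may intersect inside \<open>M\<close>.\<close>

definition graded :: "(nat \<Rightarrow> 'c set) \<Rightarrow> bool" where
  "graded C \<longleftrightarrow> (\<forall>n. submodule (C n) R M) \<and> (\<forall>n. \<forall>i<m. X i ` C n \<subseteq> C (Suc n))"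

lemma gradedD:
  assumes "graded C"
  shows "submodule (C n) R M" and "i < m \<Longrightarrow> x \<in> C n \<Longrightarrow> X i x \<in> C (Suc n)"
    and "x \<in> C n \<Longrightarrow> x \<in> carrier M"
proof -
  show *: "submodule (C n) R M" using assms unfolding graded_def by simp
  show "X i x \<in> C (Suc n)" if "i < m" "x \<in> C n"
    using assms that unfolding graded_def by blast
  show "x \<in> carrier M" if "x \<in> C n"
    by (rule submodule_mem_carrier[OF * that])
qed

lemma graded_act:
  assumes C: "graded C" and "set_mset \<delta> \<subseteq> {..<m}" "c \<in> C n"
  shows "act \<delta> c \<in> C (size \<delta> + n)"
  using assms(2)
proof (induction \<delta>)
  case empty
  then show ?case using assms by simp
next
  case (add i \<delta>)
  have "c \<in> carrier M" by (rule gradedD(3)[OF C assms(3)])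
  then have "act (add_mset i \<delta>) c = X i (act \<delta> c)"
    using add act_add_mset by simp
  then show ?case using add gradedD(2)[OF C, of i "act \<delta> c"] by simp
qed

text \<open>One variable of the nonempty \<open>\<delta>\<close> is applied last; the other factors
  already move \<open>c\<close> into \<open>C n\<close>.\<close>

lemma graded_act_mem_span:
  assumes C: "graded C" and \<delta>: "set_mset \<delta> \<subseteq> {..<m}" "\<delta> \<noteq> {#}" and c: "c \<in> C i" "size \<delta> + i = Suc n"
  shows "act \<delta> c \<in> mod_span R M (\<Union>i<m. X i ` C n)"
proof -
  obtain j \<delta>' where \<delta>': "\<delta> = add_mset j \<delta>'"
    using \<delta>(2) by (meson multiset_cases)
  have "c \<in> carrier M" by (rule gradedD(3)[OF C c(1)])
  then have "act \<delta> c = X j (act \<delta>' c)"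
    using \<delta> act_add_mset by (simp add: \<delta>')
  moreover have "act \<delta>' c \<in> C n"
    using graded_act[OF C _ c(1), of \<delta>'] \<delta> c(2) by (simp add: \<delta>')
  moreover have "j < m" using \<delta>(1) by (simp add: \<delta>')
  ultimately have "act \<delta> c \<in> (\<Union>i<m. X i ` C n)" by blast
  then show ?thesis by (rule subsetD[OF mod_span_upper])
qed

text \<open>The leading coefficients at the monomial \<open>\<alpha>\<close> of the elements of \<open>C\<close>, with respect to the
  multiset order.\<close>

definition lead :: "'c set \<Rightarrow> (nat \<Rightarrow> 'c set) \<Rightarrow> nat multiset \<Rightarrow> 'c set" where
  "lead V C \<alpha> = {v \<in> V. act \<alpha> v \<in> C (size \<alpha>) <+>\<^bsub>M\<^esub> monom_span V {\<beta> \<in> monoms (size \<alpha>). \<beta> < \<alpha>}}"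

lemma monoms_less_subset: "{\<beta> \<in> monoms n. \<beta> < \<alpha>} \<subseteq> {\<alpha>. set_mset \<alpha> \<subseteq> {..<m}}"
  unfolding monoms_def by blast

lemma submodule_lead:
  assumes "submodule V R M" "graded C" "set_mset \<alpha> \<subseteq> {..<m}"
  shows "submodule (lead V C \<alpha>) R M"
  unfolding lead_def
  by (intro submodule_hom_preimage act_hom submodule_set_add submodule_monom_span
      monoms_less_subset submoduleE(1) assms) (rule gradedD(1)[OF assms(2)])

text \<open>Multiplying by the monomial \<open>\<beta> - \<alpha>\<close> keeps the coefficient of
  the leading term and moves that term from \<open>\<alpha>\<close> to
  \<open>\<beta>\<close>.\<close>

lemma lead_mono:
  assumes V: "submodule V R M" and C: "graded C" and \<beta>: "set_mset \<beta> \<subseteq> {..<m}" and "\<alpha> \<subseteq># \<beta>"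
  shows "lead V C \<alpha> \<subseteq> lead V C \<beta>"
proof
  note V' = submoduleE(1)[OF V]
  define \<delta> where "\<delta> = \<beta> - \<alpha>"
  have \<beta>_eq: "\<beta> = \<delta> + \<alpha>" using assms(4) by (simp add: \<delta>_def)
  have \<alpha>: "set_mset \<alpha> \<subseteq> {..<m}" and \<delta>: "set_mset \<delta> \<subseteq> {..<m}"
    using \<beta> by (auto simp: \<beta>_eq)
  fix v assume "v \<in> lead V C \<alpha>"
  then have v: "v \<in> V"
    and "act \<alpha> v \<in> C (size \<alpha>) <+>\<^bsub>M\<^esub> monom_span V {\<beta> \<in> monoms (size \<alpha>). \<beta> < \<alpha>}"
    by (auto simp: lead_def)
  then obtain c w where c: "c \<in> C (size \<alpha>)" and w: "w \<in> monom_span V {\<beta> \<in> monoms (size \<alpha>). \<beta> < \<alpha>}"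
    and eq: "act \<alpha> v = c \<oplus>\<^bsub>M\<^esub> w"
    unfolding mem_set_add_iff by blast
  have cM: "c \<in> carrier M" by (rule gradedD(3)[OF C c])
  have wM: "w \<in> carrier M"
    using submodule_mem_carrier[OF submodule_monom_span[OF V' monoms_less_subset] w] .
  have "act \<beta> v = act \<delta> (act \<alpha> v)"
    unfolding \<beta>_eq using act_add[OF \<delta> \<alpha>] v V' by blast
  also have "\<dots> = act \<delta> c \<oplus>\<^bsub>M\<^esub> act \<delta> w"
    unfolding eq by (rule mod_homD(2)[OF act_hom[OF \<delta>] cM wM])
  finally have "act \<beta> v = act \<delta> c \<oplus>\<^bsub>M\<^esub> act \<delta> w" .
  moreover have "act \<delta> c \<in> C (size \<beta>)"
    using graded_act[OF C \<delta> c] by (simp add: \<beta>_eq)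
  moreover have "act \<delta> w \<in> monom_span V {\<gamma> \<in> monoms (size \<beta>). \<gamma> < \<beta>}"
  proof -
    \<comment> \<open>The multiset order is invariant under translation, so lower terms stay
      lower.\<close>
    have "(+) \<delta> ` {\<beta> \<in> monoms (size \<alpha>). \<beta> < \<alpha>} \<subseteq> {\<gamma> \<in> monoms (size \<beta>). \<gamma> < \<beta>}"
      using \<delta> by (auto simp: monoms_def \<beta>_eq)
    from act_image_monom_span[OF V' monoms_less_subset monoms_less_subset \<delta> this] w
    show ?thesis by blast
  qed
  ultimately show "v \<in> lead V C \<beta>"
    using v unfolding lead_def mem_set_add_iff by blast
qed

text \<open>Infinitely many jumps would contain a strictly increasing chain of monomials. Along it
  the leading coefficient modules ascend inside \<open>V\<close>, so two consecutive ones agree, and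
  the larger monomial is no jump.\<close>

lemma finite_lead_jumps:
  assumes V: "submodule V R M" "noeth_submodule V" and C: "graded C"
  shows "finite {\<alpha>. set_mset \<alpha> \<subseteq> {..<m} \<and> (\<forall>\<gamma>. \<gamma> \<subset># \<alpha> \<longrightarrow> lead V C \<gamma> \<noteq> lead V C \<alpha>)}" (is "finite ?B")
proof (rule ccontr)
  assume "infinite ?B"
  then obtain a :: "nat \<Rightarrow> nat multiset" where a: "inj a" "range a \<subseteq> ?B"
    using infinite_countable_subset by blast
  then have am: "set_mset (a n) \<subseteq> {..<m}" for n by blast
  obtain r :: "nat \<Rightarrow> nat" where r: "strict_mono r" "\<And>i j. i \<le> j \<Longrightarrow> a (r i) \<subseteq># a (r j)"
    by (rule dickson_mset[of "{..<m}" a]) (use am in auto)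
  have "\<exists>n. \<forall>i\<ge>n. lead V C (a (r i)) = lead V C (a (r n))"
  proof (rule V(2)[unfolded noeth_submodule_def, rule_format], intro conjI)
    fix n
    show "submodule (lead V C (a (r n))) R M" by (rule submodule_lead[OF V(1) C am])
    show "lead V C (a (r n)) \<subseteq> V" by (auto simp: lead_def)
    show "lead V C (a (r n)) \<subseteq> lead V C (a (r (Suc n)))"
      by (rule lead_mono[OF V(1) C am r(2)]) simp
  qed
  then obtain n where "lead V C (a (r (Suc n))) = lead V C (a (r n))"
    using le_SucI by blast
  moreover have "a (r n) \<noteq> a (r (Suc n))"
    using a(1) r(1) by (metis inj_eq lessI less_irrefl strict_mono_less)
  then have "a (r n) \<subset># a (r (Suc n))"
    using r(2)[of n "Suc n"] by (simp add: subset_mset.less_le)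
  moreover have "a (r (Suc n)) \<in> ?B" using a(2) by blast
  ultimately show False by auto
qed

text \<open>Above the degrees of all jumps, a leading coefficient at \<open>b\<close> already occurs
  at a proper divisor \<open>\<gamma>\<close>. The leading term can thus be cancelled by a multiple,
  by a monomial of positive degree, of an element of lower degree, and one descends along the
  well-founded monomial order.\<close>

lemma graded_eventually_generated:
  assumes V: "submodule V R M" "noeth_submodule V" and C: "graded C"
    and CF: "\<And>n. C n \<subseteq> monom_span V (monoms n)"
  obtains n0 where "\<And>n. n \<ge> n0 \<Longrightarrow> C (Suc n) \<subseteq> mod_span R M (\<Union>i<m. X i ` C n)"
proof -
  note V' = submoduleE(1)[OF V(1)]
  have subC: "submodule (C n) R M" for n by (rule gradedD(1)[OF C])
  \<comment> \<open>\<open>n0\<close> bounds the degrees of the finitely many jumps.\<close>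
  obtain n0 where n0: "\<And>\<alpha>. set_mset \<alpha> \<subseteq> {..<m} \<Longrightarrow> size \<alpha> > n0 \<Longrightarrow> \<exists>\<gamma>. \<gamma> \<subset># \<alpha> \<and> lead V C \<gamma> = lead V C \<alpha>"
  proof -
    have "finite (size ` {\<alpha>. set_mset \<alpha> \<subseteq> {..<m} \<and> (\<forall>\<gamma>. \<gamma> \<subset># \<alpha> \<longrightarrow> lead V C \<gamma> \<noteq> lead V C \<alpha>)})"
      using finite_lead_jumps[OF V C] by simp
    then obtain n0 where "\<forall>n \<in> size ` {\<alpha>. set_mset \<alpha> \<subseteq> {..<m} \<and>
        (\<forall>\<gamma>. \<gamma> \<subset># \<alpha> \<longrightarrow> lead V C \<gamma> \<noteq> lead V C \<alpha>)}. n \<le> n0"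
      unfolding finite_nat_set_iff_bounded_le by blast
    then show thesis
      by (intro that[of n0]) (use leD in auto)
  qed
  have "C (Suc n) \<subseteq> mod_span R M (\<Union>i<m. X i ` C n)" if n: "n \<ge> n0" for n
  proof -
    define G where "G = mod_span R M (\<Union>i<m. X i ` C n)"
    define W where "W \<alpha> = monom_span V {\<beta> \<in> monoms (Suc n). \<beta> < \<alpha>}" for \<alpha>
    have subW: "submodule (W \<alpha>) R M" for \<alpha>
      unfolding W_def by (rule submodule_monom_span[OF V' monoms_less_subset])
    have subG: "submodule G R M"
      unfolding G_def
    proof (rule submodule_mod_span, clarify)
      fix i x assume "i < m" "x \<in> C n"
      then show "X i x \<in> carrier M"
        using mod_homD(1)[OF endo] submodule_mem_carrier[OF subC] by blast
    qed
    \<comment> \<open>The induction is on a strict upper bound \<open>\<alpha>\<close> for the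
      monomials occurring in the element.\<close>
    have "C (Suc n) \<inter> W \<alpha> \<subseteq> G" for \<alpha>
    proof (induction \<alpha> rule: less_induct)
      case (less \<alpha>)
      define T where "T = {\<beta> \<in> monoms (Suc n). \<beta> < \<alpha>}"
      have finT: "finite T" unfolding T_def using finite_monoms by simp
      show ?case
      proof (cases "T = {}")
        case True
        then have "W \<alpha> \<subseteq> {\<zero>\<^bsub>M\<^esub>}"
          unfolding W_def T_def monom_span_def by (intro mod_span_least[OF submodule_zero]) auto
        then show ?thesis using submodule_zero_closed[OF subG] by blast
      next
        case False
        \<comment> \<open>The only possible leading monomial below \<open>\<alpha>\<close>; its
          coefficient \<open>v\<close> may be zero.\<close>
        define b where "b = Max T"
        have b: "b \<in> T" unfolding b_def by (rule Max_in[OF finT False])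
        then have bm: "set_mset b \<subseteq> {..<m}" and sb: "size b = Suc n" and "b < \<alpha>"
          by (auto simp: T_def monoms_def)
        have "T \<subseteq> insert b {\<beta> \<in> monoms (Suc n). \<beta> < b}"
          using Max_ge[OF finT] unfolding b_def T_def by (auto simp: le_less)
        then have WW: "W \<alpha> \<subseteq> act b ` V <+>\<^bsub>M\<^esub> W b"
          unfolding W_def T_def
          using monom_span_mono monom_span_insert[OF V(1) monoms_less_subset bm] by (meson order_trans)
        show ?thesis
        proof
          fix x assume x: "x \<in> C (Suc n) \<inter> W \<alpha>"
          then have "x \<in> act b ` V <+>\<^bsub>M\<^esub> W b" using WW by blast
          then obtain v w where v: "v \<in> V" and w: "w \<in> W b" and x_eq: "x = act b v \<oplus>\<^bsub>M\<^esub> w"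
            unfolding mem_set_add_iff by blast
          have vM: "v \<in> carrier M" and wM: "w \<in> carrier M" and bvM: "act b v \<in> carrier M"
            and xM: "x \<in> carrier M"
            using v V' w submodule_mem_carrier[OF subW] act_closed[OF bm] x
              submodule_mem_carrier[OF subC] by auto
          have "act b v = x \<oplus>\<^bsub>M\<^esub> (\<ominus>\<^bsub>M\<^esub> w)"
            unfolding x_eq using bvM wM by (simp add: M.a_assoc M.r_neg)
          then have "v \<in> lead V C b"
            using v x submoduleE(3)[OF subW w]
            unfolding lead_def mem_set_add_iff sb W_def by blast
          moreover obtain \<gamma> where \<gamma>: "\<gamma> \<subset># b" "lead V C \<gamma> = lead V C b"
            using n0[OF bm] sb n by auto
          ultimately have "v \<in> lead V C \<gamma>" by simp
          then obtain c u where c: "c \<in> C (size \<gamma>)" 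
            and u: "u \<in> monom_span V {\<beta> \<in> monoms (size \<gamma>). \<beta> < \<gamma>}"
            and \<gamma>v: "act \<gamma> v = c \<oplus>\<^bsub>M\<^esub> u"
            unfolding lead_def mem_set_add_iff by blast
          define \<delta> where "\<delta> = b - \<gamma>"
          have b_eq: "b = \<delta> + \<gamma>" and \<delta>0: "\<delta> \<noteq> {#}"
            using \<gamma>(1) by (auto simp: \<delta>_def subset_mset.less_le Diff_eq_empty_iff_mset)
          have \<gamma>m: "set_mset \<gamma> \<subseteq> {..<m}" and \<delta>m: "set_mset \<delta> \<subseteq> {..<m}"
            using bm by (auto simp: b_eq)
          have sz: "size \<delta> + size \<gamma> = Suc n"
            using sb by (simp add: b_eq)
          have cM: "c \<in> carrier M" by (rule submodule_mem_carrier[OF subC c])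
          have uM: "u \<in> carrier M"
            using submodule_mem_carrier[OF submodule_monom_span[OF V' monoms_less_subset] u] .
          have \<delta>cM: "act \<delta> c \<in> carrier M" and \<delta>uM: "act \<delta> u \<in> carrier M"
            using act_closed[OF \<delta>m] cM uM by auto
          have bv: "act b v = act \<delta> c \<oplus>\<^bsub>M\<^esub> act \<delta> u"
            unfolding b_eq act_add[OF \<delta>m \<gamma>m vM] \<gamma>v by (rule mod_homD(2)[OF act_hom[OF \<delta>m] cM uM])
          have \<delta>cG: "act \<delta> c \<in> G"
            unfolding G_def by (rule graded_act_mem_span[OF C \<delta>m \<delta>0 c sz])
          have \<delta>cC: "act \<delta> c \<in> C (Suc n)"
            using graded_act[OF C \<delta>m c] sz by simp
          have "(+) \<delta> ` {\<beta> \<in> monoms (size \<gamma>). \<beta> < \<gamma>} \<subseteq> {\<beta> \<in> monoms (Suc n). \<beta> < b}"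
            using \<delta>m sz by (auto simp: monoms_def b_eq)
          from act_image_monom_span[OF V' monoms_less_subset monoms_less_subset \<delta>m this]
          have \<delta>uW: "act \<delta> u \<in> W b"
            using u unfolding W_def by blast
          \<comment> \<open>What is left of \<open>x\<close> after subtracting
            \<open>act \<delta> c\<close>: the term at \<open>b\<close> is gone and only monomials
            below \<open>b\<close> remain.\<close>
          define y where "y = act \<delta> u \<oplus>\<^bsub>M\<^esub> w"
          have yM: "y \<in> carrier M" unfolding y_def using \<delta>uM wM by simp
          have x_eq': "x = act \<delta> c \<oplus>\<^bsub>M\<^esub> y"
            unfolding x_eq bv y_def using \<delta>cM \<delta>uM wM by (simp add: M.a_assoc)
          then have "y = x \<ominus>\<^bsub>M\<^esub> act \<delta> c"
            using \<delta>cM yM by (simp add: a_minus_def M.a_comm[of "act \<delta> c"] M.a_assoc M.r_neg)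
          then have "y \<in> C (Suc n)"
            using submodule_minus_closed[OF subC] x \<delta>cC by simp
          moreover have "y \<in> W b"
            unfolding y_def by (rule submoduleE(5)[OF subW \<delta>uW w])
          ultimately have "y \<in> G" using less[OF \<open>b < \<alpha>\<close>] by blast
          then show "x \<in> G" unfolding x_eq' by (rule submoduleE(5)[OF subG \<delta>cG])
        qed
      qed
    qed
    \<comment> \<open>The out-of-range index \<open>m\<close> gives a multiset above all monomials.\<close>
    moreover have "monoms (Suc n) \<subseteq> {\<beta> \<in> monoms (Suc n). \<beta> < {#m#}}"
      by (auto simp: monoms_def)
    then have "C (Suc n) \<subseteq> W {#m#}"
      unfolding W_def using CF monom_span_mono by (meson order_trans)
    ultimately show ?thesis unfolding G_def by blast
  qed
  then show thesis by (rule that)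
qed

lemma graded_monom_span:
  assumes V: "submodule V R M"
  shows "graded (\<lambda>n. monom_span V (monoms n))"
  unfolding graded_def
proof (intro conjI allI impI)
  note V' = submoduleE(1)[OF V]
  have mon: "monoms n \<subseteq> {\<alpha>. set_mset \<alpha> \<subseteq> {..<m}}" for n
    by (auto simp: monoms_def)
  fix n
  show "submodule (monom_span V (monoms n)) R M"
    by (rule submodule_monom_span[OF V' mon])
  fix i assume i: "i < m"
  have "act {#i#} = X i" by (auto simp: act_def)
  moreover have "(+) {#i#} ` monoms n \<subseteq> monoms (Suc n)"
    using i by (auto simp: monoms_def)
  ultimately show "X i ` monom_span V (monoms n) \<subseteq> monom_span V (monoms (Suc n))"
    using act_image_monom_span[OF V' mon mon, of "{#i#}" n "Suc n"] i by simp
qed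

end

section \<open>Lengths of submodules\<close>

text \<open>A length function takes modules on a fixed carrier type, so quotients are realised on
  representatives of the cosets.\<close>

lemma (in module) module_retract:
  assumes r_closed: "\<And>x. x \<in> carrier M \<Longrightarrow> r x \<in> carrier M"
    and r_add: "\<And>x y. x \<in> carrier M \<Longrightarrow> y \<in> carrier M \<Longrightarrow> r (r x \<oplus>\<^bsub>M\<^esub> y) = r (x \<oplus>\<^bsub>M\<^esub> y)"
    and r_smult: "\<And>a x. a \<in> carrier R \<Longrightarrow> x \<in> carrier M \<Longrightarrow> r (a \<odot>\<^bsub>M\<^esub> r x) = r (a \<odot>\<^bsub>M\<^esub> x)"
  shows "module R (M\<lparr>carrier := r ` carrier M, zero := r \<zero>\<^bsub>M\<^esub>,
      add := \<lambda>x y. r (x \<oplus>\<^bsub>M\<^esub> y), smult := \<lambda>a x. r (a \<odot>\<^bsub>M\<^esub> x)\<rparr>)"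
proof -
  have r_add2: "r (x \<oplus>\<^bsub>M\<^esub> r y) = r (x \<oplus>\<^bsub>M\<^esub> y)" if "x \<in> carrier M" "y \<in> carrier M" for x y
    using r_add[of y x] that r_closed by (simp add: M.a_comm)
  note simps = r_closed r_add r_add2 r_smult
  have assoc: "r (r (r x \<oplus>\<^bsub>M\<^esub> r y) \<oplus>\<^bsub>M\<^esub> r z) = r (r x \<oplus>\<^bsub>M\<^esub> r (r y \<oplus>\<^bsub>M\<^esub> r z))"
    if "x \<in> carrier M" "y \<in> carrier M" "z \<in> carrier M" for x y z
  proof -
    have "r (r (r x \<oplus>\<^bsub>M\<^esub> r y) \<oplus>\<^bsub>M\<^esub> r z) = r ((x \<oplus>\<^bsub>M\<^esub> y) \<oplus>\<^bsub>M\<^esub> z)"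
      using that by (simp add: simps)
    also have "\<dots> = r (x \<oplus>\<^bsub>M\<^esub> (y \<oplus>\<^bsub>M\<^esub> z))"
      using that by (simp add: M.a_assoc)
    also have "\<dots> = r (r x \<oplus>\<^bsub>M\<^esub> r (r y \<oplus>\<^bsub>M\<^esub> r z))"
      using that by (simp add: simps)
    finally show ?thesis .
  qed
  have r_idem: "r (r x) = r x" if "x \<in> carrier M" for x
    using r_add[of x "\<zero>\<^bsub>M\<^esub>"] that by (simp add: r_closed)
  show ?thesis
  proof (rule moduleI)
    show "cring R" by (rule R.cring_axioms)
    show "abelian_group (M\<lparr>carrier := r ` carrier M, zero := r \<zero>\<^bsub>M\<^esub>,
      add := \<lambda>x y. r (x \<oplus>\<^bsub>M\<^esub> y), smult := \<lambda>a x. r (a \<odot>\<^bsub>M\<^esub> x)\<rparr>)"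
    proof (rule abelian_groupI, simp_all, safe)
      fix x assume x: "x \<in> carrier M"
      show "r (r \<zero>\<^bsub>M\<^esub> \<oplus>\<^bsub>M\<^esub> r x) = r x"
        using x by (simp add: simps)
      show "\<exists>y\<in>carrier M. r (r y \<oplus>\<^bsub>M\<^esub> r x) = r \<zero>\<^bsub>M\<^esub>"
        using x by (intro bexI[of _ "\<ominus>\<^bsub>M\<^esub> x"]) (simp_all add: simps M.l_neg)
      fix y assume y: "y \<in> carrier M"
      show "r (r x \<oplus>\<^bsub>M\<^esub> r y) = r (r y \<oplus>\<^bsub>M\<^esub> r x)"
        using x y by (simp add: r_closed M.a_comm)
    qed (auto simp: assoc r_closed)
  qed (auto simp: r_idem simps smult_r_distr, auto simp: smult_l_distr smult_assoc1)
qed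

lemma quotient_module_exists:
  fixes M :: "('a, 'c) module" and R :: "('a, 'x) ring_scheme"
  assumes M: "module R M" and B: "submodule B R M"
  obtains Q :: "('a, 'c) module" and q where "module R Q" "mod_hom R M Q q"
    "q ` carrier M = carrier Q" "{x \<in> carrier M. q x = \<zero>\<^bsub>Q\<^esub>} = B"
proof -
  interpret module R M by (rule M)
  note Bcl = submoduleE(3-5)[OF B] submodule_zero_closed[OF B] 
  \<comment> \<open>The predicate depends only on the coset of \<open>x\<close>, so the chosen
    representative is the same for all its members.\<close>
  define r where "r x = (SOME y. y \<in> carrier M \<and> y \<ominus>\<^bsub>M\<^esub> x \<in> B)" for x
  have r: "r x \<in> carrier M" "r x \<ominus>\<^bsub>M\<^esub> x \<in> B" if "x \<in> carrier M" for x
  proof -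
    have "x \<in> carrier M \<and> x \<ominus>\<^bsub>M\<^esub> x \<in> B"
      using that Bcl by (simp add: a_minus_def M.r_neg)
    from someI[of "\<lambda>y. y \<in> carrier M \<and> y \<ominus>\<^bsub>M\<^esub> x \<in> B", OF this]
    show "r x \<in> carrier M" "r x \<ominus>\<^bsub>M\<^esub> x \<in> B" unfolding r_def by blast+
  qed
  have trans: "x \<ominus>\<^bsub>M\<^esub> z \<in> B"
    if "x \<ominus>\<^bsub>M\<^esub> y \<in> B" "y \<ominus>\<^bsub>M\<^esub> z \<in> B" "x \<in> carrier M" "y \<in> carrier M" "z \<in> carrier M" for x y z
  proof -
    have "x \<ominus>\<^bsub>M\<^esub> z = (x \<ominus>\<^bsub>M\<^esub> y) \<oplus>\<^bsub>M\<^esub> (y \<ominus>\<^bsub>M\<^esub> z)"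
      using that by (simp add: a_minus_def M.a_assoc M.r_neg1)
    then show ?thesis using Bcl(3) that by simp
  qed
  have sym: "y \<ominus>\<^bsub>M\<^esub> x \<in> B" if "x \<ominus>\<^bsub>M\<^esub> y \<in> B" "x \<in> carrier M" "y \<in> carrier M" for x y
  proof -
    have "y \<ominus>\<^bsub>M\<^esub> x = \<ominus>\<^bsub>M\<^esub> (x \<ominus>\<^bsub>M\<^esub> y)"
      using that by (simp add: a_minus_def M.minus_add M.a_comm)
    then show ?thesis using Bcl(1) that by simp
  qed
  have r_eq_iff: "r x = r y \<longleftrightarrow> x \<ominus>\<^bsub>M\<^esub> y \<in> B" if "x \<in> carrier M" "y \<in> carrier M" for x y
  proof
    assume "r x = r y"
    then have "r x \<ominus>\<^bsub>M\<^esub> y \<in> B" using r(2)[OF that(2)] by simp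
    then show "x \<ominus>\<^bsub>M\<^esub> y \<in> B"
      using trans[OF sym[OF r(2)]] r(1) that by simp
  next
    assume "x \<ominus>\<^bsub>M\<^esub> y \<in> B"
    then have "(z \<in> carrier M \<and> z \<ominus>\<^bsub>M\<^esub> x \<in> B) = (z \<in> carrier M \<and> z \<ominus>\<^bsub>M\<^esub> y \<in> B)" for z
      using trans[of z x y] trans[of z y x] sym that by blast
    then show "r x = r y" unfolding r_def by simp
  qed
  have r_add: "r (r x \<oplus>\<^bsub>M\<^esub> y) = r (x \<oplus>\<^bsub>M\<^esub> y)" if "x \<in> carrier M" "y \<in> carrier M" for x y
  proof -
    have "(r x \<oplus>\<^bsub>M\<^esub> y) \<ominus>\<^bsub>M\<^esub> (x \<oplus>\<^bsub>M\<^esub> y) = r x \<ominus>\<^bsub>M\<^esub> x"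
      using that r(1)[OF that(1)]
      by (simp add: a_minus_def M.minus_add M.a_assoc M.a_comm[of "\<ominus>\<^bsub>M\<^esub> x"] M.r_neg2)
    then show ?thesis using r that by (simp add: r_eq_iff)
  qed
  have r_smult: "r (a \<odot>\<^bsub>M\<^esub> r x) = r (a \<odot>\<^bsub>M\<^esub> x)" if "a \<in> carrier R" "x \<in> carrier M" for a x
  proof -
    have "(a \<odot>\<^bsub>M\<^esub> r x) \<ominus>\<^bsub>M\<^esub> (a \<odot>\<^bsub>M\<^esub> x) = a \<odot>\<^bsub>M\<^esub> (r x \<ominus>\<^bsub>M\<^esub> x)"
      using that r(1)[OF that(2)] by (simp add: a_minus_def smult_r_distr smult_r_minus)
    then show ?thesis using r that Bcl(2) by (simp add: r_eq_iff)
  qed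
  have r_add2: "r (r x \<oplus>\<^bsub>M\<^esub> r y) = r (x \<oplus>\<^bsub>M\<^esub> y)" if "x \<in> carrier M" "y \<in> carrier M" for x y
    using r_add[of x "r y"] r_add[of y x] r that by (simp add: M.a_comm)
  define Q where "Q = M\<lparr>carrier := r ` carrier M, zero := r \<zero>\<^bsub>M\<^esub>,
      add := \<lambda>x y. r (x \<oplus>\<^bsub>M\<^esub> y), smult := \<lambda>a x. r (a \<odot>\<^bsub>M\<^esub> x)\<rparr>"
  show thesis
  proof (rule that)
    show "module R Q"
      unfolding Q_def by (rule module_retract) (simp_all add: r(1) r_add r_smult)
    show "mod_hom R M Q r"
      unfolding mod_hom_def Q_def by (simp add: r_add2 r_smult)
    show "r ` carrier M = carrier Q" by (simp add: Q_def)
    show "{x \<in> carrier M. r x = \<zero>\<^bsub>Q\<^esub>} = B"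
    proof -
      have "x \<ominus>\<^bsub>M\<^esub> \<zero>\<^bsub>M\<^esub> = x" if "x \<in> carrier M" for x
        using that by (simp add: a_minus_def)
      then show ?thesis
        using submodule_mem_carrier[OF B] by (auto simp: Q_def r_eq_iff)
    qed
  qed
qed

locale length_module = module R M
  for R :: "('a, 'x) ring_scheme" (structure) and M :: "('a, 'c) module" (structure) +
  fixes l :: "('a, 'c) module \<Rightarrow> ennreal"
  assumes length: "length_function R l"
begin

definition len :: "'c set \<Rightarrow> ennreal" where
  "len H = l (M\<lparr>carrier := H\<rparr>)"

lemma submodule_module: "submodule H R M \<Longrightarrow> module R (M\<lparr>carrier := H\<rparr>)"
  by (rule submodule.submodule_is_module[OF _ module_axioms])

lemma length_exact:
  assumes "module R A" "module R B" "module R C" "mod_hom R A B f" "mod_hom R B C g"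
    "inj_on f (carrier A)" "g ` carrier B = carrier C"
    "f ` carrier A = {y \<in> carrier B. g y = \<zero>\<^bsub>C\<^esub>}"
  shows "l B = l A + l C"
  using length assms unfolding length_function_def by blast

lemma len_zero: "len {\<zero>\<^bsub>M\<^esub>} = 0"
  using length submodule_module[OF submodule_zero] unfolding length_function_def len_def by simp

lemma submodule_restrict:
  assumes "submodule B R M" "submodule H R M" "B \<subseteq> H"
  shows "submodule B R (M\<lparr>carrier := H\<rparr>)"
  using module.module_incl_imp_submodule[OF submodule_module[OF assms(2)], of B]
    submodule_module[OF assms(1)] assms(3) by simp

lemma len_exact:
  assumes A: "submodule A R M" and K: "submodule K R M" "K \<subseteq> A" and Q: "module R Q"
    and g: "mod_hom R (M\<lparr>carrier := A\<rparr>) Q g" "g ` A = carrier Q" "{a \<in> A. g a = \<zero>\<^bsub>Q\<^esub>} = K"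
  shows "len A = len K + l Q"
  unfolding len_def
  by (rule length_exact[OF submodule_module[OF K(1)] submodule_module[OF A] Q _ g(1), of "\<lambda>x. x"])
    (use K(2) g in \<open>auto simp: mod_hom_def\<close>)

text \<open>Additivity expresses the length of \<open>A\<close> as that of \<open>B\<close> plus a
  nonnegative length of the quotient.\<close>

lemma len_mono:
  assumes "submodule A R M" "submodule B R M" "B \<subseteq> A"
  shows "len B \<le> len A"
proof -
  obtain Q :: "('a, 'c) module" and q where "module R Q" "mod_hom R (M\<lparr>carrier := A\<rparr>) Q q"
    "q ` carrier (M\<lparr>carrier := A\<rparr>) = carrier Q" "{x \<in> carrier (M\<lparr>carrier := A\<rparr>). q x = \<zero>\<^bsub>Q\<^esub>} = B"
    by (rule quotient_module_exists[OF submodule_module[OF assms(1)]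
          submodule_restrict[OF assms(2,1,3)]])
  then have "len A = len B + l Q"
    using len_exact[OF assms(1,2,3), of Q q] by simp
  then show ?thesis by simp
qed

text \<open>The map \<open>h\<close> induces an isomorphism from \<open>A / {a \<in> A. h a \<in> B}\<close> to \<open>(h A + B) / B\<close>.\<close>

lemma len_hom_add:
  assumes A: "submodule A R M" and B: "submodule B R M" and h: "mod_hom R M M h"
  shows "len (h ` A <+>\<^bsub>M\<^esub> B) + len {a \<in> A. h a \<in> B} = len A + len B"
proof -
  define H where "H = h ` A <+>\<^bsub>M\<^esub> B"
  note hA = submodule_hom_image[OF h A]
  have H: "submodule H R M" unfolding H_def by (rule submodule_set_add[OF hA B])
  have BH: "B \<subseteq> H" unfolding H_def by (rule set_add_upper2[OF hA submoduleE(1)[OF B]])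
  have AH: "h ` A \<subseteq> H" unfolding H_def by (rule set_add_upper1[OF submoduleE(1)[OF hA] B])
  obtain Q :: "('a, 'c) module" and q where Q: "module R Q" "mod_hom R (M\<lparr>carrier := H\<rparr>) Q q"
    "q ` carrier (M\<lparr>carrier := H\<rparr>) = carrier Q" "{x \<in> carrier (M\<lparr>carrier := H\<rparr>). q x = \<zero>\<^bsub>Q\<^esub>} = B"
    by (rule quotient_module_exists[OF submodule_module[OF H] submodule_restrict[OF B H BH]])
  interpret Q: module R Q by (rule Q(1))
  have q_closed: "\<And>x. x \<in> H \<Longrightarrow> q x \<in> carrier Q"
    and q_add: "\<And>x y. x \<in> H \<Longrightarrow> y \<in> H \<Longrightarrow> q (x \<oplus>\<^bsub>M\<^esub> y) = q x \<oplus>\<^bsub>Q\<^esub> q y"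
    and q_smult: "\<And>a x. a \<in> carrier R \<Longrightarrow> x \<in> H \<Longrightarrow> q (a \<odot>\<^bsub>M\<^esub> x) = a \<odot>\<^bsub>Q\<^esub> q x"
    using Q(2) unfolding mod_hom_def by simp_all
  have qB: "q x = \<zero>\<^bsub>Q\<^esub> \<longleftrightarrow> x \<in> B" if "x \<in> H" for x
    using Q(4) that by auto
  \<comment> \<open>Facts 1 and 2 contain the same \<open>l Q\<close>. Adding them crosswise gives
    the claim without cancelling lengths that may be infinite.\<close>
  have 1: "len H = len B + l Q"
    using len_exact[OF H B BH Q(1,2)] Q(3,4) by simp
  have hH: "h a \<in> H" if "a \<in> A" for a using AH that by blast
  note cA = submodule_mem_carrier[OF A]
  have 2: "len A = len {a \<in> A. h a \<in> B} + l Q"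
  proof (rule len_exact[OF A submodule_hom_preimage[OF h A B] _ Q(1)])
    show "mod_hom R (M\<lparr>carrier := A\<rparr>) Q (\<lambda>a. q (h a))"
      unfolding mod_hom_def
      by (simp add: hH q_closed q_add q_smult mod_homD(2)[OF h cA cA] mod_homD(3)[OF h _ cA])
    show "{a \<in> A. q (h a) = \<zero>\<^bsub>Q\<^esub>} = {a \<in> A. h a \<in> B}"
      using qB hH by auto
    have "carrier Q \<subseteq> (\<lambda>a. q (h a)) ` A"
    proof
      fix y assume "y \<in> carrier Q"
      then obtain x where x: "x \<in> H" "y = q x" using Q(3) by auto
      then obtain a b where ab: "a \<in> A" "b \<in> B" "x = h a \<oplus>\<^bsub>M\<^esub> b"
        unfolding H_def mem_set_add_iff by blast
      then have "b \<in> H" "q b = \<zero>\<^bsub>Q\<^esub>" using qB BH by auto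
      then have "y = q (h a)"
        using x ab hH q_closed by (simp add: q_add)
      then show "y \<in> (\<lambda>a. q (h a)) ` A" using ab by blast
    qed
    then show "(\<lambda>a. q (h a)) ` A = carrier Q" using hH q_closed by auto
  qed blast
  show ?thesis
    using 1 2 unfolding H_def by (simp add: ac_simps)
qed

lemma len_hom_add_le:
  assumes "submodule A R M" "submodule B R M" "mod_hom R M M h"
  shows "len (h ` A <+>\<^bsub>M\<^esub> B) \<le> len A + len B"
  using len_hom_add[OF assms] by (metis le_iff_add)

end

section \<open>Hilbert series\<close>

text \<open>\<open>enn2real\<close> sends \<infinity> to 0, so additivity is restricted to finite
  values.\<close>

lemma enn2real_add: "a < \<infinity> \<Longrightarrow> b < \<infinity> \<Longrightarrow> enn2real (a + b) = enn2real a + enn2real b"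
  by (cases a; cases b) (auto simp flip: ennreal_plus)

locale hilbert_module = commuting_endos R M m X + length_module R M l
  for R :: "('a, 'x) ring_scheme" (structure) and M :: "('a, 'c) module" (structure)
    and m X and l :: "('a, 'c) module \<Rightarrow> ennreal" +
  fixes V :: "'c set"
  assumes noeth: "noetherian_ring R" and fg: "fg_submodule R M V" and len_V: "len V < \<infinity>"
begin

abbreviation F :: "nat \<Rightarrow> 'c set" where
  "F n \<equiv> monom_span V (monoms n)"

lemma V_submodule: "submodule V R M"
  using fg unfolding fg_submodule_def by blast

lemma V_noeth: "noeth_submodule V"
  using fg noeth_submodule_mod_span[OF noeth] unfolding fg_submodule_def by blast

lemma graded_F: "graded F"
  by (rule graded_monom_span[OF V_submodule])

lemma F_0_subset: "F 0 \<subseteq> V"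
proof -
  have "monoms 0 = {{#}}" by (auto simp: monoms_def)
  then show ?thesis
    unfolding monom_span_def by (intro mod_span_least[OF V_submodule]) auto
qed

lemma F_Suc_subset: "F (Suc n) \<subseteq> mod_span R M (\<Union>i<m. X i ` F n)"
  unfolding monom_span_def[of V "monoms (Suc n)"]
proof (rule mod_span_least)
  have gen: "(\<Union>i<m. X i ` F n) \<subseteq> carrier M"
    using gradedD(3)[OF graded_F gradedD(2)[OF graded_F]] by blast
  show "submodule (mod_span R M (\<Union>i<m. X i ` F n)) R M"
    by (rule submodule_mod_span[OF gen])
  show "{act \<beta> v |\<beta> v. \<beta> \<in> monoms (Suc n) \<and> v \<in> V} \<subseteq> mod_span R M (\<Union>i<m. X i ` F n)"
  proof clarify
    fix \<beta> v assume \<beta>: "\<beta> \<in> monoms (Suc n)" and v: "v \<in> V"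
    obtain i \<gamma> where \<beta>_eq: "\<beta> = add_mset i \<gamma>"
      using \<beta> by (cases \<beta>) (auto simp: monoms_def)
    then have i: "i < m" and \<gamma>: "set_mset \<gamma> \<subseteq> {..<m}" "\<gamma> \<in> monoms n"
      using \<beta> by (auto simp: monoms_def)
    have "act \<beta> v = X i (act \<gamma> v)"
      unfolding \<beta>_eq by (rule act_add_mset[OF i \<gamma>(1) submodule_mem_carrier[OF V_submodule v]])
    moreover have "act \<gamma> v \<in> F n"
      unfolding monom_span_def by (rule subsetD[OF mod_span_upper]) (use \<gamma>(2) v in blast)
    ultimately have "act \<beta> v \<in> (\<Union>i<m. X i ` F n)" using i by blast
    then show "act \<beta> v \<in> mod_span R M (\<Union>i<m. X i ` F n)" by (rule subsetD[OF mod_span_upper])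
  qed
qed

text \<open>\<open>F (Suc n)\<close> lies in the sum of the \<open>m\<close> images of
  \<open>F n\<close>, and each image adds at most the length of \<open>F n\<close>.\<close>

lemma len_F: "len (F n) < \<infinity>"
proof (induction n)
  case 0
  show ?case
    using len_mono[OF V_submodule gradedD(1)[OF graded_F] F_0_subset] len_V by (rule le_less_trans)
next
  case (Suc n)
  \<comment> \<open>The images are added one variable at a time; \<open>U j\<close> collects the
    first \<open>j\<close>.\<close>
  define U where "U j = mod_span R M (\<Union>i<j. X i ` F n)" for j
  have gen: "(\<Union>i<j. X i ` F n) \<subseteq> carrier M" if "j \<le> m" for j
  proof clarify
    fix i x assume "i < j" "x \<in> F n"
    then show "X i x \<in> carrier M"
      using gradedD(3)[OF graded_F gradedD(2)[OF graded_F]] that by simp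
  qed
  have subU: "submodule (U j) R M" if "j \<le> m" for j
    unfolding U_def by (rule submodule_mod_span[OF gen[OF that]])
  have "len (U j) < \<infinity>" if "j \<le> m" for j
    using that
  proof (induction j)
    case 0
    have "U 0 \<subseteq> {\<zero>\<^bsub>M\<^esub>}"
      unfolding U_def by (rule mod_span_least[OF submodule_zero]) simp
    from len_mono[OF submodule_zero subU this] show ?case
      using len_zero by simp
  next
    case (Suc j)
    then have j: "j < m" "j \<le> m" by auto
    note XF = submodule_hom_image[OF endo[OF j(1)] gradedD(1)[OF graded_F, of n]]
    note sum = submodule_set_add[OF XF subU[OF j(2)]]
    have "U (Suc j) \<subseteq> X j ` F n <+>\<^bsub>M\<^esub> U j"
      unfolding U_def[of "Suc j"]
    proof (rule mod_span_least[OF sum])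
      have "(\<Union>i<j. X i ` F n) \<subseteq> U j" unfolding U_def by (rule mod_span_upper)
      then show "(\<Union>i<Suc j. X i ` F n) \<subseteq> X j ` F n <+>\<^bsub>M\<^esub> U j"
        using set_add_upper1[OF submoduleE(1)[OF XF] subU[OF j(2)]]
          set_add_upper2[OF XF submoduleE(1)[OF subU[OF j(2)]]]
        by (auto simp: lessThan_Suc)
    qed
    from len_mono[OF sum subU[OF Suc.prems] this]
    have "len (U (Suc j)) \<le> len (X j ` F n <+>\<^bsub>M\<^esub> U j)" .
    also have "\<dots> \<le> len (F n) + len (U j)"
      by (rule len_hom_add_le[OF gradedD(1)[OF graded_F] subU[OF j(2)] endo[OF j(1)]])
    also have "\<dots> < \<infinity>"
      using \<open>len (F n) < \<infinity>\<close> Suc.IH[OF j(2)] by simp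
    finally show ?case .
  qed
  from this[OF order_refl]
  show ?case
    using len_mono[OF subU[OF order_refl] gradedD(1)[OF graded_F] F_Suc_subset[of n, folded U_def]]
    by (rule le_less_trans[rotated])
qed

section \<open>Real-valued lengths and the induction on the number of variables\<close>

definition rlen :: "'c set \<Rightarrow> real" where
  "rlen H = enn2real (len H)"

text \<open>The sum on the left equals a finite one, so both of its terms are finite and the
  identity passes to real numbers.\<close>

lemma rlen_hom_add:
  assumes A: "submodule A R M" "len A < \<infinity>" and B: "submodule B R M" "len B < \<infinity>" and h: "mod_hom R M M h"
  shows "rlen (h ` A <+>\<^bsub>M\<^esub> B) + rlen {a \<in> A. h a \<in> B} = rlen A + rlen B"
proof -
  have eq: "len (h ` A <+>\<^bsub>M\<^esub> B) + len {a \<in> A. h a \<in> B} = len A + len B"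
    by (rule len_hom_add[OF A(1) B(1) h])
  have "len (h ` A <+>\<^bsub>M\<^esub> B) + len {a \<in> A. h a \<in> B} < \<infinity>"
    unfolding eq using A(2) B(2) by simp
  then have "len (h ` A <+>\<^bsub>M\<^esub> B) < \<infinity>" "len {a \<in> A. h a \<in> B} < \<infinity>"
    by simp_all
  then show ?thesis
    unfolding rlen_def using arg_cong[OF eq, of enn2real] A(2) B(2)
    by (simp add: enn2real_add)
qed

lemma len_finite: "submodule A R M \<Longrightarrow> A \<subseteq> F n \<Longrightarrow> len A < \<infinity>"
  using len_mono[OF gradedD(1)[OF graded_F]] len_F by (rule le_less_trans)

text \<open>The pair \<open>A, B\<close> stands for the graded module \<open>A / B\<close>, killed by the variables from \<open>j\<close> on.
  Multiplication by the variable \<open>j\<close> has kernel \<open>K / B\<close> and cokernel \<open>A / D\<close>, both killed by one more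
  variable.\<close>

lemma hilbert_series_rational:
  assumes "j \<le> m" "graded A" "graded B" "\<And>n. B n \<subseteq> A n" "\<And>n. A n \<subseteq> F n"
    "\<And>i n. j \<le> i \<Longrightarrow> i < m \<Longrightarrow> X i ` A n \<subseteq> B (Suc n)"
  shows "\<exists>p :: real poly. Abs_fps (\<lambda>n. rlen (A n) - rlen (B n)) * (1 - fps_X) ^ j = fps_of_poly p"
  using assms
proof (induction j arbitrary: A B)
  case 0
  note A = \<open>graded A\<close> and B = \<open>graded B\<close>
  obtain n0 where n0: "\<And>n. n \<ge> n0 \<Longrightarrow> A (Suc n) \<subseteq> mod_span R M (\<Union>i<m. X i ` A n)"
    using graded_eventually_generated[OF V_submodule V_noeth A 0(5)] by blast
  \<comment> \<open>With \<open>j = 0\<close> every variable maps \<open>A\<close> into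
    \<open>B\<close>, so the generators of \<open>A (Suc n)\<close> lie in
    \<open>B (Suc n)\<close>.\<close>
  have eq: "A (Suc n) = B (Suc n)" if "n \<ge> n0" for n
  proof
    have "mod_span R M (\<Union>i<m. X i ` A n) \<subseteq> B (Suc n)"
      by (rule mod_span_least[OF gradedD(1)[OF B]]) (use 0(6) in auto)
    then show "A (Suc n) \<subseteq> B (Suc n)" using n0[OF that] by simp
  qed (rule 0(4))
  define g where "g n = rlen (A n) - rlen (B n)" for n
  have "g n = 0" if "n > n0" for n
    using eq[of "n - 1"] that unfolding g_def by simp
  \<comment> \<open>The coefficients vanish above degree \<open>n0\<close>, so the series is its
    truncation to \<open>Suc n0\<close> coefficients.\<close>
  then have "Abs_fps g = fps_of_poly (Poly (map g [0..<Suc n0]))"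
    by (intro fps_ext) (auto simp: nth_default_def not_less simp del: upt_Suc)
  then show ?case unfolding g_def by auto
next
  case (Suc j)
  note A = \<open>graded A\<close> and B = \<open>graded B\<close> and BA = Suc.prems(4) and AF = Suc.prems(5)
  have j: "j < m" "j \<le> m" using Suc.prems(1) by auto
  note Xj = endo[OF j(1)]
  define K where "K n = {a \<in> A n. X j a \<in> B (Suc n)}" for n
  \<comment> \<open>Preimage in \<open>A\<close> of the image of multiplication by the variable
    \<open>j\<close> on \<open>A / B\<close>. Multiplication raises the degree by one, so nothing
    reaches degree 0 and \<open>D 0\<close> is just \<open>B 0\<close>.\<close>
  define D where "D n = (case n of 0 \<Rightarrow> B 0 | Suc n' \<Rightarrow> X j ` A n' <+>\<^bsub>M\<^esub> B n)" for n
  note subA = gradedD(1)[OF A] and subB = gradedD(1)[OF B]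
  note XA = submodule_hom_image[OF Xj subA]
  have D_Suc: "D (Suc n) = X j ` A n <+>\<^bsub>M\<^esub> B (Suc n)" for n by (simp add: D_def)
  have BD: "B n \<subseteq> D n" for n
    using set_add_upper2[OF XA submoduleE(1)[OF subB]] by (cases n) (auto simp: D_def)
  have XAD: "X j ` A n \<subseteq> D (Suc n)" for n
    unfolding D_Suc by (rule set_add_upper1[OF submoduleE(1)[OF XA] subB])
  have subD: "submodule (D n) R M" for n
    using submodule_set_add[OF XA subB] subB by (cases n) (auto simp: D_def)
  have DA: "D n \<subseteq> A n" for n
  proof (cases n)
    case 0
    then show ?thesis using BA by (simp add: D_def)
  next
    case (Suc n')
    have "X j ` A n' \<subseteq> A n" using gradedD(2)[OF A j(1)] Suc by blast
    then show ?thesis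
      using set_add_least[OF subA _ BA] by (simp add: Suc D_Suc)
  qed
  have gD: "graded D"
    unfolding graded_def
  proof (intro conjI allI impI subD)
    fix n i assume i: "i < m"
    show "X i ` D n \<subseteq> D (Suc n)"
    proof (cases n)
      case 0
      then show ?thesis using gradedD(2)[OF B i] BD[of "Suc n"] by (auto simp: D_def)
    next
      case (Suc n')
      show ?thesis
      proof clarify
        fix d assume "d \<in> D n"
        then obtain a b where a: "a \<in> A n'" and b: "b \<in> B n" and d: "d = X j a \<oplus>\<^bsub>M\<^esub> b"
          unfolding Suc D_Suc mem_set_add_iff by blast
        have aM: "a \<in> carrier M" and bM: "b \<in> carrier M"
          using gradedD(3)[OF A a] gradedD(3)[OF B b] by auto
        have "X i d = X j (X i a) \<oplus>\<^bsub>M\<^esub> X i b"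
          unfolding d mod_homD(2)[OF endo[OF i] mod_homD(1)[OF Xj aM] bM]
          by (simp add: endo_commute[OF i j(1) aM])
        moreover have "X i a \<in> A n" using gradedD(2)[OF A i a] by (simp add: Suc)
        moreover have "X i b \<in> B (Suc n)" by (rule gradedD(2)[OF B i b])
        ultimately show "X i d \<in> D (Suc n)"
          unfolding D_Suc mem_set_add_iff by blast
      qed
    qed
  qed
  have subK: "submodule (K n) R M" for n
    unfolding K_def by (rule submodule_hom_preimage[OF Xj subA subB])
  have gK: "graded K"
    unfolding graded_def
  proof (intro conjI allI impI subK subsetI)
    fix n i x assume i: "i < m" and "x \<in> X i ` K n"
    then obtain a where a: "a \<in> A n" "X j a \<in> B (Suc n)" "x = X i a" by (auto simp: K_def)
    then have "X j x = X i (X j a)"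
      using endo_commute[OF j(1) i gradedD(3)[OF A a(1)]] by simp
    then have "X j x \<in> B (Suc (Suc n))" using gradedD(2)[OF B i a(2)] by simp
    then show "x \<in> K (Suc n)"
      using gradedD(2)[OF A i a(1)] a(3) by (simp add: K_def)
  qed
  have KA: "K n \<subseteq> A n" for n by (auto simp: K_def)
  have BK: "B n \<subseteq> K n" for n
    using BA gradedD(2)[OF B j(1)] by (auto simp: K_def)
  have "\<exists>p :: real poly. Abs_fps (\<lambda>n. rlen (A n) - rlen (D n)) * (1 - fps_X) ^ j = fps_of_poly p"
  proof (rule Suc.IH[OF j(2) A gD DA AF])
    fix i n assume "j \<le> i" "i < m"
    then show "X i ` A n \<subseteq> D (Suc n)"
      using XAD[of n] Suc.prems(6)[of i n] BD[of "Suc n"] by (cases "i = j") auto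
  qed
  then obtain p :: "real poly"
    where p: "Abs_fps (\<lambda>n. rlen (A n) - rlen (D n)) * (1 - fps_X) ^ j = fps_of_poly p" ..
  have "\<exists>p :: real poly. Abs_fps (\<lambda>n. rlen (K n) - rlen (B n)) * (1 - fps_X) ^ j = fps_of_poly p"
  proof (rule Suc.IH[OF j(2) gK B BK])
    show "K n \<subseteq> F n" for n using KA AF by blast
    fix i n assume "j \<le> i" "i < m"
    then show "X i ` K n \<subseteq> B (Suc n)"
      using Suc.prems(6)[of i n] KA[of n] by (cases "i = j") (auto simp: K_def)
  qed
  then obtain q :: "real poly"
    where q: "Abs_fps (\<lambda>n. rlen (K n) - rlen (B n)) * (1 - fps_X) ^ j = fps_of_poly q" ..
  \<comment> \<open>Numerically: \<open>A n / K n\<close> is isomorphic to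
    \<open>D (Suc n) / B (Suc n)\<close> via the variable \<open>j\<close>.\<close>
  have step: "rlen (D (Suc n)) + rlen (K n) = rlen (A n) + rlen (B (Suc n))" for n
    unfolding D_Suc K_def
    by (rule rlen_hom_add[OF subA len_finite[OF subA AF] subB _ Xj])
      (rule len_finite[OF subB order_trans[OF BA AF]])
  \<comment> \<open>The factor \<open>fps_X\<close> records the degree shift of the multiplication.
    In degree 0 the identity is \<open>D 0 = B 0\<close>, in higher degrees it is
    \<open>step\<close> one degree lower.\<close>
  have "Abs_fps (\<lambda>n. rlen (A n) - rlen (B n)) * (1 - fps_X)
      = Abs_fps (\<lambda>n. rlen (A n) - rlen (D n)) - fps_X * Abs_fps (\<lambda>n. rlen (K n) - rlen (B n))"
  proof (rule fps_ext)
    fix n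
    show "fps_nth (Abs_fps (\<lambda>n. rlen (A n) - rlen (B n)) * (1 - fps_X)) n
      = fps_nth (Abs_fps (\<lambda>n. rlen (A n) - rlen (D n))
          - fps_X * Abs_fps (\<lambda>n. rlen (K n) - rlen (B n))) n"
      using step[of "n - 1"] by (cases n) (auto simp: algebra_simps D_def)
  qed
  then have "Abs_fps (\<lambda>n. rlen (A n) - rlen (B n)) * (1 - fps_X) ^ Suc j
      = (Abs_fps (\<lambda>n. rlen (A n) - rlen (D n)) - fps_X * Abs_fps (\<lambda>n. rlen (K n) - rlen (B n)))
        * (1 - fps_X) ^ j"
    by (simp only: power_Suc mult.assoc[symmetric])
  also have "\<dots> = fps_of_poly p - fps_X * fps_of_poly q"
    by (simp only: left_diff_distrib mult.assoc p q)
  also have "\<dots> = fps_of_poly (p - [:0, 1:] * q)"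
    by (simp add: fps_of_poly_diff fps_of_poly_mult fps_of_poly_pCons)
  finally show ?case by blast
qed

lemma hilbert_series:
  "\<exists>p :: real poly. Abs_fps (\<lambda>n. rlen (F n)) = fps_of_poly p / (1 - fps_X) ^ m"
proof -
  \<comment> \<open>The induction is started with \<open>B\<close> zero and \<open>j = m\<close>,
    where the condition on variables from \<open>j\<close> on is vacuous.\<close>
  have zero: "graded (\<lambda>n. {\<zero>\<^bsub>M\<^esub>})"
    unfolding graded_def using submodule_zero mod_hom_zero[OF endo] by simp
  have "\<exists>p :: real poly. Abs_fps (\<lambda>n. rlen (F n) - rlen {\<zero>\<^bsub>M\<^esub>}) * (1 - fps_X) ^ m = fps_of_poly p"
    by (rule hilbert_series_rational[OF order_refl graded_F zero])
      (use submodule_zero_closed[OF gradedD(1)[OF graded_F]] in auto)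
  then obtain p :: "real poly" where p: "Abs_fps (\<lambda>n. rlen (F n)) * (1 - fps_X) ^ m = fps_of_poly p"
    by (auto simp: rlen_def len_zero)
  have "fps_nth (1 - fps_X :: real fps) 0 \<noteq> 0" by simp
  then have "(1 - fps_X :: real fps) \<noteq> 0" by (metis fps_zero_nth)
  then have "Abs_fps (\<lambda>n. rlen (F n)) = fps_of_poly p / (1 - fps_X) ^ m"
    unfolding p[symmetric] by simp
  then show ?thesis ..
qed

end

text \<open>The identity as an additional last variable homogenises: words of length at most \<open>n\<close> become
  words of length exactly \<open>n\<close>.\<close>

lemma SnV_eq_monom_span:
  assumes ce: "commuting_endos R N (Suc k) (X(k := \<lambda>x. x))" and V: "V \<subseteq> carrier N"
  shows "SnV R N k X V n = commuting_endos.monom_span R N (X(k := \<lambda>x. x)) V (commuting_endos.monoms (Suc k) n)"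
proof -
  interpret commuting_endos R N "Suc k" "X(k := \<lambda>x. x)" by (rule ce)
  let ?X = "X(k := \<lambda>x. x)"
  have foldr_eq: "foldr ?X ws v = foldr X (filter (\<lambda>i. i \<noteq> k) ws) v" for ws v
    by (induction ws) auto
  have "{foldr X ws v | ws v. set ws \<subseteq> {..<k} \<and> length ws \<le> n \<and> v \<in> V}
      = {act \<beta> v | \<beta> v. \<beta> \<in> monoms n \<and> v \<in> V}" (is "?L = ?R")
  proof
    show "?L \<subseteq> ?R"
    proof clarify
      fix ws v assume ws: "set ws \<subseteq> {..<k}" "length ws \<le> n" and v: "v \<in> V"
      \<comment> \<open>Padding with the letter \<open>k\<close>, which acts as the identity, brings
        the word to length exactly \<open>n\<close>; filtering removes it again.\<close>
      define us where "us = ws @ replicate (n - length ws) k"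
      have "filter (\<lambda>i. i \<noteq> k) us = ws"
        using ws(1) by (auto simp: us_def intro!: filter_True)
      then have "foldr X ws v = foldr ?X us v" by (simp only: foldr_eq)
      also have "\<dots> = act (mset us) v"
        by (rule foldr_eq_act) (use ws(1) v V in \<open>auto simp: us_def\<close>)
      finally have "foldr X ws v = act (mset us) v" .
      moreover have "mset us \<in> monoms n"
        using ws by (auto simp: monoms_def us_def)
      ultimately show "\<exists>\<beta> v'. foldr X ws v = act \<beta> v' \<and> \<beta> \<in> monoms n \<and> v' \<in> V"
        using v by blast
    qed
    show "?R \<subseteq> ?L"
    proof clarify
      fix \<beta> v assume \<beta>: "\<beta> \<in> monoms n" and v: "v \<in> V"
      define ws where "ws = filter (\<lambda>i. i \<noteq> k) (sorted_list_of_multiset \<beta>)"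
      have "act \<beta> v = foldr X ws v"
        unfolding act_def foldr_eq ws_def ..
      moreover have "set ws \<subseteq> {..<k}"
        using \<beta> by (force simp: ws_def monoms_def)
      moreover have "length ws \<le> n"
        using \<beta> length_filter_le[of _ "sorted_list_of_multiset \<beta>"]
        by (auto simp: ws_def monoms_def simp flip: size_mset)
      ultimately show "\<exists>ws v'. act \<beta> v = foldr X ws v' \<and> set ws \<subseteq> {..<k} \<and> length ws \<le> n \<and> v' \<in> V"
        using v by blast
    qed
  qed
  then show ?thesis unfolding SnV_def monom_span_def by simp
qed

theorem theorem4p9:
  fixes R :: "'a ring" and N :: "('a, 'c) module"
    and l :: "('a, 'c) module \<Rightarrow> ennreal"
    and k :: nat and X :: "nat \<Rightarrow> 'c \<Rightarrow> 'c" and V0 :: "'c set"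
  assumes "cring R" and "noetherian_ring R"
    and "length_function R l"
    and "module R N"
    and "\<And>i. i < k \<Longrightarrow> mod_hom R N N (X i)"
    and "\<And>i j v. i < k \<Longrightarrow> j < k \<Longrightarrow> v \<in> carrier N \<Longrightarrow> X i (X j v) = X j (X i v)"
    and "fg_submodule R N V0"
    and "l (N\<lparr>carrier := V0\<rparr>) < \<infinity>"
  shows "(\<forall>n. l (N\<lparr>carrier := SnV R N k X V0 n\<rparr>) < \<infinity>) \<and>
    (\<exists>p :: real poly.
       Abs_fps (\<lambda>n. enn2real (l (N\<lparr>carrier := SnV R N k X V0 n\<rparr>)))
         = fps_of_poly p / (1 - fps_X) ^ (k + 1))"
proof -
  have lm: "length_module R N l"
    by (rule length_module.intro[OF assms(4) length_module_axioms.intro[OF assms(3)]])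
  \<comment> \<open>The identity occupies index \<open>k\<close> and commutes with every
    endomorphism; the resulting \<open>Suc k\<close> variables account for the exponent
    \<open>k + 1\<close>.\<close>
  define Y where "Y = X(k := \<lambda>x. x)"
  have ce: "commuting_endos R N (Suc k) Y"
  proof (rule commuting_endos.intro[OF assms(4) commuting_endos_axioms.intro])
    show "mod_hom R N N (Y i)" if "i < Suc k" for i
      using that assms(5) module.mod_hom_id[OF assms(4)] by (cases "i = k") (auto simp: Y_def)
    show "Y i (Y j v) = Y j (Y i v)" if "i < Suc k" "j < Suc k" "v \<in> carrier N" for i j v
      using that assms(6)[of i j v] by (auto simp: Y_def)
  qed
  have hm: "hilbert_module R N (Suc k) Y l V0"
    by (rule hilbert_module.intro[OF ce lm hilbert_module_axioms.intro[OF assms(2,7)]])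
      (simp only: length_module.len_def[OF lm] assms(8))
  interpret hilbert_module R N "Suc k" Y l V0 by (rule hm)
  have S: "SnV R N k X V0 n = F n" for n
    using SnV_eq_monom_span[of R N k X V0 n] ce submoduleE(1)[OF V_submodule] by (simp add: Y_def)
  show ?thesis
    unfolding S using len_F hilbert_series unfolding rlen_def len_def by simp
qed

end
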